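(* Let $G\le\mathrm{Aut}(T)$ be a finitely generated weakly branch group, and let $X$ be a minimal compact $G$-space on which $G$ acts faithfully. Assume that the orbital growth of the action satisfies $\mathrm{vol}_{G,X}(n)\preceq n^d$ for some $d\ge1$. Then there exists a continuous $G$-equivariant map $q:X\to\mathcal{F}(\partial T)$ with infinite image. In particular $X$ factors onto an infinite profinite $G$-space.
   Context: $T$ is a locally finite rooted tree, $\mathrm{Aut}(T)$ its root-fixing automorphisms, $\partial T$ its boundary. $G$ is weakly branch if $T$ is infinite and spherically homogeneous, $G$ is transitive on each level, and for every vertex $v$ the subgroup of elements acting trivially outside the subtree below $v$ is non-trivial. $\mathcal{F}(\partial T)$ is the space of closed subsets of $\partial T$ with the Hausdorff topology. For a finite symmetric generating set $S$, $\mathrm{vol}_{G,X}(n)=\sup_{x\in X}|B_S(n)\cdot x|$ with $B_S(n)$ the word-metric ball; $f\preceq g$ means $f(n)\le Cg(Cn)$ for some $C>0$. A $G$-space is profinite if it is an inverse limit of finite $G$-sets. *)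

theory Defs
  imports "HOL-Analysis.Analysis"
begin

text \<open>Vertices at level n are words w of length n with w!i < m i; the root is [];
  the parent of a non-root vertex v is butlast v.\<close>

definition tree_vertices :: "(nat \<Rightarrow> nat) \<Rightarrow> nat list set" where
  "tree_vertices m = {w. \<forall>i<length w. w ! i < m i}"

definition tree_level :: "(nat \<Rightarrow> nat) \<Rightarrow> nat \<Rightarrow> nat list set" where
  "tree_level m n = {w \<in> tree_vertices m. length w = n}"

definition tree_aut :: "(nat \<Rightarrow> nat) \<Rightarrow> (nat list \<Rightarrow> nat list) \<Rightarrow> bool" where
  "tree_aut m f \<longleftrightarrow> bij_betw f (tree_vertices m) (tree_vertices m)
     \<and> (\<forall>v\<in>tree_vertices m. length (f v) = length v \<and> f (butlast v) = butlast (f v))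
     \<and> (\<forall>v. v \<notin> tree_vertices m \<longrightarrow> f v = v)"

definition aut_group :: "(nat \<Rightarrow> nat) \<Rightarrow> (nat list \<Rightarrow> nat list) set \<Rightarrow> bool" where
  "aut_group m G \<longleftrightarrow> (\<forall>g\<in>G. tree_aut m g) \<and> id \<in> G
     \<and> (\<forall>g\<in>G. \<forall>h\<in>G. g \<circ> h \<in> G) \<and> (\<forall>g\<in>G. inv g \<in> G)"

definition word_ball :: "(nat list \<Rightarrow> nat list) set \<Rightarrow> nat \<Rightarrow> (nat list \<Rightarrow> nat list) set" where
  "word_ball S n = {foldr (\<circ>) ws id | ws. set ws \<subseteq> S \<and> length ws \<le> n}"

definition fin_sym_gen_set ::
  "(nat list \<Rightarrow> nat list) set \<Rightarrow> (nat list \<Rightarrow> nat list) set \<Rightarrow> bool" where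
  "fin_sym_gen_set G S \<longleftrightarrow> finite S \<and> S \<subseteq> G \<and> (\<forall>s\<in>S. inv s \<in> S)
     \<and> G = (\<Union>n. word_ball S n)"

definition finitely_generated :: "(nat list \<Rightarrow> nat list) set \<Rightarrow> bool" where
  "finitely_generated G \<longleftrightarrow> (\<exists>S. fin_sym_gen_set G S)"

definition rist :: "(nat \<Rightarrow> nat) \<Rightarrow> (nat list \<Rightarrow> nat list) set \<Rightarrow> nat list
                     \<Rightarrow> (nat list \<Rightarrow> nat list) set" where
  "rist m G v = {g \<in> G. \<forall>u\<in>tree_vertices m. take (length v) u \<noteq> v \<longrightarrow> g u = u}"

definition weakly_branch :: "(nat \<Rightarrow> nat) \<Rightarrow> (nat list \<Rightarrow> nat list) set \<Rightarrow> bool" where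
  "weakly_branch m G \<longleftrightarrow> (\<forall>k. 0 < m k)
     \<and> (\<forall>n. \<forall>v\<in>tree_level m n. \<forall>w\<in>tree_level m n. \<exists>g\<in>G. g v = w)
     \<and> (\<forall>v\<in>tree_vertices m. \<exists>g\<in>rist m G v. g \<noteq> id)"

definition boundary_top :: "(nat \<Rightarrow> nat) \<Rightarrow> (nat \<Rightarrow> nat) topology" where
  "boundary_top m = product_topology (\<lambda>k. discrete_topology {..<m k}) UNIV"

definition bdist :: "(nat \<Rightarrow> nat) \<Rightarrow> (nat \<Rightarrow> nat) \<Rightarrow> real" where
  "bdist \<xi> \<eta> = (if \<xi> = \<eta> then 0 else (1/2) ^ (LEAST k. \<xi> k \<noteq> \<eta> k))"

text \<open>Hausdorff distance between closed subsets (the empty set is at distance 1,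
  the diameter bound, from every non-empty set, so it is isolated).\<close>

definition hausdorff_dist :: "(nat \<Rightarrow> nat) set \<Rightarrow> (nat \<Rightarrow> nat) set \<Rightarrow> real" where
  "hausdorff_dist A B =
     (if A = {} \<and> B = {} then 0
      else if A = {} \<or> B = {} then 1
      else max (SUP a\<in>A. INF b\<in>B. bdist a b) (SUP b\<in>B. INF a\<in>A. bdist a b))"

definition ray_act :: "(nat list \<Rightarrow> nat list) \<Rightarrow> (nat \<Rightarrow> nat) \<Rightarrow> (nat \<Rightarrow> nat)" where
  "ray_act g \<xi> = (\<lambda>k. g (map \<xi> [0..<Suc k]) ! k)"

definition G_action :: "(nat list \<Rightarrow> nat list) set \<Rightarrow>
     ((nat list \<Rightarrow> nat list) \<Rightarrow> 'x::topological_space \<Rightarrow> 'x) \<Rightarrow> bool" where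
  "G_action G act \<longleftrightarrow> (\<forall>g\<in>G. continuous_on UNIV (act g)) \<and> act id = id
     \<and> (\<forall>g\<in>G. \<forall>h\<in>G. act (g \<circ> h) = act g \<circ> act h)"

definition faithful_action :: "(nat list \<Rightarrow> nat list) set \<Rightarrow>
     ((nat list \<Rightarrow> nat list) \<Rightarrow> 'x \<Rightarrow> 'x) \<Rightarrow> bool" where
  "faithful_action G act \<longleftrightarrow> (\<forall>g\<in>G. act g = id \<longrightarrow> g = id)"

definition minimal_action :: "(nat list \<Rightarrow> nat list) set \<Rightarrow>
     ((nat list \<Rightarrow> nat list) \<Rightarrow> 'x::topological_space \<Rightarrow> 'x) \<Rightarrow> bool" where
  "minimal_action G act \<longleftrightarrow> (\<forall>x. closure ((\<lambda>g. act g x) ` G) = UNIV)"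

definition orbital_growth :: "(nat list \<Rightarrow> nat list) set \<Rightarrow>
     ((nat list \<Rightarrow> nat list) \<Rightarrow> 'x \<Rightarrow> 'x) \<Rightarrow> nat \<Rightarrow> nat" where
  "orbital_growth S act n = (SUP x. card ((\<lambda>g. act g x) ` word_ball S n))"

end

(*
  For a vertex w let L(w) be the set of all [[a,b],[c,d]] with a, b, c, d in the rigid stabiliser
  Rist(w), and let q(x) be the set of rays none of whose vertices w satisfies L(w) <= G_x.
  The map q is equivariant, and q(x) is non-empty because L(w) is non-trivial and the action is
  faithful and minimal.  Continuity is automatic: an equivariant family of closed subsets of X
  indexed by a level of the tree consists of clopen sets, since by minimality every point lies in
  the same number of its members.

  The range of q is infinite as soon as below every vertex v there is a w with L(w) <= G_x.
  Products of conjugates of elements of Rist(w_1), ..., Rist(w_k), for distinct w_i on one level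
  below v, grow at least like n^k; for k > d this forces a finite set P of non-trivial elements of
  Rist(v) that meets every point stabiliser.  Conjugating P by elements supported below vertices u
  moved by its members shows that for some such u the elements of Rist(u) which agree below u with
  an element of G_x form a subgroup Q of finite index.  The first step applied to u also gives a
  non-trivial h in Rist(u) fixing x; let w0 be a vertex moved by h.  For c, c' in Q supported
  below w0 the double commutator [[h, c^-1], c'] = [c, c'] then lies in G_x.  Finally, a subgroup
  of finite index contains all commutators of Rist(w) for some w below w0.
*)
theory Submission
  imports Defs
begin

section \<open>The tree and rigid stabilisers\<close>

definition subtree :: "(nat \<Rightarrow> nat) \<Rightarrow> nat list \<Rightarrow> nat list set" where
  "subtree m v = {u \<in> tree_vertices m. take (length v) u = v}"

definition commutator :: "('a \<Rightarrow> 'a) \<Rightarrow> ('a \<Rightarrow> 'a) \<Rightarrow> 'a \<Rightarrow> 'a" where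
  "commutator a b = a \<circ> b \<circ> inv a \<circ> inv b"

lemma take_tree_vertices: "v \<in> tree_vertices m \<Longrightarrow> take k v \<in> tree_vertices m"
  by (auto simp: tree_vertices_def)

lemma subtree_subset: "w \<in> subtree m v \<Longrightarrow> subtree m w \<subseteq> subtree m v"
proof
  fix u assume w: "w \<in> subtree m v" and u: "u \<in> subtree m w"
  have "take (length v) u = take (length v) (take (length w) u)"
    using w by (auto simp: subtree_def min_def)
  also have "\<dots> = v" using w u by (auto simp: subtree_def)
  finally show "u \<in> subtree m v" using u by (auto simp: subtree_def)
qed

lemma subtree_disjoint: "length v = length w \<Longrightarrow> v \<noteq> w \<Longrightarrow> subtree m v \<inter> subtree m w = {}"
  by (auto simp: subtree_def)

lemma subtree_vertices: "u \<in> subtree m v \<Longrightarrow> u \<in> tree_vertices m"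
  by (auto simp: subtree_def)

lemma subtree_length: "u \<in> subtree m v \<Longrightarrow> length v \<le> length u"
  by (auto simp: subtree_def) (metis length_take min.bounded_iff order_refl)

lemma finite_tree_level: "finite (tree_level m n)"
proof -
  define M where "M = Max (m ` {..<n})"
  have "tree_level m n \<subseteq> {w. set w \<subseteq> {..M} \<and> length w = n}"
  proof
    fix w assume w: "w \<in> tree_level m n"
    have "x \<le> M" if "x \<in> set w" for x
    proof -
      obtain i where i: "i < n" "w ! i = x"
        using \<open>x \<in> set w\<close> w by (auto simp: in_set_conv_nth tree_level_def)
      have "x < m i" using i w by (auto simp: tree_level_def tree_vertices_def)
      also have "m i \<le> M" using i by (auto simp: M_def)
      finally show ?thesis by simp
    qed
    then show "w \<in> {w. set w \<subseteq> {..M} \<and> length w = n}"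
      using w by (auto simp: tree_level_def)
  qed
  then show ?thesis
    by (rule finite_subset) (simp add: finite_lists_length_eq)
qed

locale weakly_branch_group =
  fixes m :: "nat \<Rightarrow> nat" and G :: "(nat list \<Rightarrow> nat list) set"
  assumes aut: "aut_group m G" and wb: "weakly_branch m G"
begin

abbreviation "V \<equiv> tree_vertices m"
abbreviation "Rist \<equiv> rist m G"

lemma tree_aut: "g \<in> G \<Longrightarrow> tree_aut m g"
  using aut by (auto simp: aut_group_def)

lemma id_in_G [simp]: "id \<in> G"
  and comp_in_G [simp]: "g \<in> G \<Longrightarrow> h \<in> G \<Longrightarrow> g \<circ> h \<in> G"
  and inv_in_G [simp]: "g \<in> G \<Longrightarrow> inv g \<in> G"
  using aut by (auto simp: aut_group_def)

lemma in_V [simp]: "g \<in> G \<Longrightarrow> g v \<in> V \<longleftrightarrow> v \<in> V"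
  using tree_aut[of g] unfolding tree_aut_def by (metis bij_betwE)

lemma length_G [simp]: "g \<in> G \<Longrightarrow> length (g v) = length v"
  using tree_aut[of g] unfolding tree_aut_def by metis

text \<open>Automorphisms fix all lists outside the tree, so they permute the whole type and
  \<open>inv\<close> is the group inverse.\<close>

lemma bij_G: "g \<in> G \<Longrightarrow> bij g"
proof -
  assume g: "g \<in> G"
  note t = tree_aut[OF g, unfolded tree_aut_def]
  have 1: "bij_betw g V V" using t by auto
  have 2: "bij_betw g (-V) (-V)" using t by (auto simp: bij_betw_def inj_on_def image_def)
  show "bij g" using bij_betw_combine[OF 1 2] by simp
qed

lemma G_inv_left [simp]: "g \<in> G \<Longrightarrow> inv g (g v) = v"
  by (simp add: bij_G bij_is_inj inv_f_f)

lemma G_inv_right [simp]: "g \<in> G \<Longrightarrow> g (inv g v) = v"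
  by (simp add: bij_G bij_is_surj surj_f_inv_f)

lemma G_inv_left_comp [simp]: "g \<in> G \<Longrightarrow> inv g \<circ> g = id"
  and G_inv_right_comp [simp]: "g \<in> G \<Longrightarrow> g \<circ> inv g = id"
  by (auto simp: fun_eq_iff)

lemma G_inv_inv [simp]: "g \<in> G \<Longrightarrow> inv (inv g) = g"
  by (simp add: bij_G inv_inv_eq)

lemma G_inv_comp: "g \<in> G \<Longrightarrow> h \<in> G \<Longrightarrow> inv (g \<circ> h) = inv h \<circ> inv g"
  by (simp add: bij_G o_inv_distrib)

lemma G_eq_iff [simp]: "g \<in> G \<Longrightarrow> g v = g w \<longleftrightarrow> v = w"
  by (metis G_inv_left)

lemma G_inv_eq_iff: "g \<in> G \<Longrightarrow> inv g v = w \<longleftrightarrow> v = g w"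
  by auto

lemma commutator_in_G [simp]: "g \<in> G \<Longrightarrow> h \<in> G \<Longrightarrow> commutator g h \<in> G"
  by (simp add: commutator_def)

text \<open>The definition of an automorphism speaks of parents only; downward induction on
  \<open>k\<close> removes one letter at a time.\<close>

lemma G_take: "g \<in> G \<Longrightarrow> v \<in> V \<Longrightarrow> g (take k v) = take k (g v)"
proof (induction "length v - k" arbitrary: k)
  case 0
  then show ?case by simp
next
  case (Suc j)
  have lt: "k < length v" using Suc by simp
  have *: "take k w = butlast (take (Suc k) w)" if "length w = length v" for w :: "nat list"
    using lt that by (simp add: butlast_take)
  have t: "take (Suc k) v \<in> V" using Suc by (simp add: take_tree_vertices)
  have "g (take k v) = g (butlast (take (Suc k) v))" using * by simp
  also have "\<dots> = butlast (g (take (Suc k) v))"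
    using tree_aut[OF \<open>g \<in> G\<close>] t by (auto simp: tree_aut_def)
  also have "\<dots> = butlast (take (Suc k) (g v))" using Suc(1)[of "Suc k"] Suc by simp
  also have "\<dots> = take k (g v)" using * Suc by simp
  finally show ?case .
qed

lemma G_subtree [simp]: "g \<in> G \<Longrightarrow> v \<in> V \<Longrightarrow> g u \<in> subtree m (g v) \<longleftrightarrow> u \<in> subtree m v"
  by (auto simp: subtree_def simp flip: G_take)

lemma G_subtree_inv: "g \<in> G \<Longrightarrow> v \<in> V \<Longrightarrow> inv g u \<in> subtree m v \<longleftrightarrow> u \<in> subtree m (g v)"
  by (metis G_subtree G_inv_right)

lemma rist_in_G: "g \<in> Rist v \<Longrightarrow> g \<in> G"
  by (auto simp: rist_def)

lemma rist_fix: "g \<in> Rist v \<Longrightarrow> u \<notin> subtree m v \<Longrightarrow> g u = u"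
proof -
  assume g: "g \<in> Rist v" and u: "u \<notin> subtree m v"
  show "g u = u"
  proof (cases "u \<in> V")
    case True then show ?thesis using g u by (auto simp: rist_def subtree_def)
  next
    case False then show ?thesis
      using tree_aut[OF rist_in_G[OF g]] by (auto simp: tree_aut_def)
  qed
qed

lemma ristI: "g \<in> G \<Longrightarrow> (\<And>u. u \<notin> subtree m v \<Longrightarrow> g u = u) \<Longrightarrow> g \<in> Rist v"
  by (auto simp: rist_def subtree_def)

lemma rist_subtree [simp]: "g \<in> Rist v \<Longrightarrow> g u \<in> subtree m v \<longleftrightarrow> u \<in> subtree m v"
  by (metis G_inv_left rist_fix rist_in_G)

lemma rist_id [simp]: "id \<in> Rist v"
  by (auto intro: ristI)

lemma rist_comp [simp]: "g \<in> Rist v \<Longrightarrow> h \<in> Rist v \<Longrightarrow> g \<circ> h \<in> Rist v"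
  by (rule ristI) (auto simp: rist_in_G rist_fix)

lemma rist_inv [simp]: "g \<in> Rist v \<Longrightarrow> inv g \<in> Rist v"
  by (rule ristI) (auto simp: rist_in_G rist_fix G_inv_eq_iff)

lemma rist_commutator [simp]: "g \<in> Rist v \<Longrightarrow> h \<in> Rist v \<Longrightarrow> commutator g h \<in> Rist v"
  by (simp add: commutator_def)

lemma rist_mono: "w \<in> subtree m v \<Longrightarrow> Rist w \<subseteq> Rist v"
  using subtree_subset by (blast intro: ristI dest: rist_in_G rist_fix)

lemma rist_conj: "g \<in> G \<Longrightarrow> v \<in> V \<Longrightarrow> a \<in> Rist v \<Longrightarrow> g \<circ> a \<circ> inv g \<in> Rist (g v)"
  by (rule ristI) (auto simp: rist_in_G rist_fix G_subtree_inv)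

lemma rist_moves: "g \<in> Rist v \<Longrightarrow> g \<noteq> id \<Longrightarrow> \<exists>u\<in>subtree m v. g u \<noteq> u"
  using rist_fix by (metis eq_id_iff)

lemma rist_nontrivial: "v \<in> V \<Longrightarrow> \<exists>g\<in>Rist v. g \<noteq> id"
  using wb by (auto simp: weakly_branch_def)

lemma transitive: "v \<in> V \<Longrightarrow> w \<in> V \<Longrightarrow> length v = length w \<Longrightarrow> \<exists>g\<in>G. g v = w"
  using wb by (auto simp: weakly_branch_def tree_level_def)

lemma m_pos: "0 < m k"
  using wb by (auto simp: weakly_branch_def)

lemma rist_commute:
  assumes "a \<in> Rist v" "b \<in> Rist w" "subtree m v \<inter> subtree m w = {}"
  shows "a (b u) = b (a u)"
proof -
  consider "u \<in> subtree m v" | "u \<in> subtree m w" | "u \<notin> subtree m v" "u \<notin> subtree m w" by blast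
  then show ?thesis
  proof cases
    case 1
    then have "u \<notin> subtree m w" "a u \<notin> subtree m w" using assms rist_subtree[of a v u] by blast+
    then show ?thesis using assms by (simp add: rist_fix)
  next
    case 2
    then have "u \<notin> subtree m v" "b u \<notin> subtree m v" using assms rist_subtree[of b w u] by blast+
    then show ?thesis using assms by (simp add: rist_fix)
  qed (use assms in \<open>simp add: rist_fix\<close>)
qed

lemma moved_subtrees_disjoint:
  assumes "g \<in> G" "g w \<noteq> w"
  shows "subtree m (g w) \<inter> subtree m w = {}"
  using assms by (intro subtree_disjoint) auto

section \<open>Branching below a vertex, infinite rigid stabilisers and conjugacy classes\<close>

lemma extend_to_level:
  assumes "v \<in> V" "length v \<le> n"
  shows "\<exists>u\<in>subtree m v. length u = n"
proof -
  have "v @ replicate (n - length v) 0 \<in> subtree m v"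
    using assms m_pos by (auto simp: subtree_def tree_vertices_def nth_append)
  then show ?thesis using assms by force
qed

text \<open>A vertex may have a single child, so the branching comes from the group: a non-trivial
  element of \<open>Rist v\<close> moves some vertex below \<open>v\<close> to another one on the
  same level.\<close>

lemma subtree_splits:
  assumes "v \<in> V"
  shows "\<exists>w1\<in>subtree m v. \<exists>w2\<in>subtree m v. w1 \<noteq> w2 \<and> length w1 = length w2"
proof -
  obtain g where g: "g \<in> Rist v" "g \<noteq> id" using rist_nontrivial assms by blast
  then obtain u where u: "u \<in> subtree m v" "g u \<noteq> u" using rist_moves by blast
  have "g u \<in> subtree m v" "length (g u) = length u"
    using g u rist_in_G by auto
  then show ?thesis using u by metis
qed

lemma finite_subtree_level: "finite {u \<in> subtree m v. length u = n}"
  by (rule finite_subset[OF _ finite_tree_level[of m n]]) (auto simp: tree_level_def subtree_def)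

text \<open>Each split contributes one more vertex: \<open>K\<close> of them below \<open>w1\<close>
  and at least one below \<open>w2\<close>. The bound holds on all deep levels so that several
  elements can later share one level.\<close>

lemma subtree_level_large:
  assumes "v \<in> V"
  shows "\<exists>n0\<ge>length v. \<forall>n\<ge>n0. K \<le> card {u \<in> subtree m v. length u = n}"
  using assms
proof (induction K arbitrary: v)
  case 0
  then show ?case by auto
next
  case (Suc K)
  obtain w1 w2 where w: "w1 \<in> subtree m v" "w2 \<in> subtree m v" "w1 \<noteq> w2" "length w1 = length w2"
    using subtree_splits[OF \<open>v \<in> V\<close>] by blast
  obtain n0 where n0: "n0 \<ge> length w1" "\<And>n. n \<ge> n0 \<Longrightarrow> K \<le> card {u \<in> subtree m w1. length u = n}"
    using Suc.IH[of w1] w subtree_vertices by blast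
  show ?case
  proof (intro exI[of _ n0] conjI allI impI)
    show "n0 \<ge> length v" using n0 w subtree_length by fastforce
    fix n assume n: "n \<ge> n0"
    obtain y where y: "y \<in> subtree m w2" "length y = n"
      using extend_to_level[of w2 n] w n n0 subtree_vertices by (metis order_trans)
    have "y \<notin> subtree m w1" using y w subtree_disjoint by blast
    have "Suc K \<le> card (insert y {u \<in> subtree m w1. length u = n})"
      using n0(2)[OF n] \<open>y \<notin> subtree m w1\<close> finite_subtree_level by simp
    also have "\<dots> \<le> card {u \<in> subtree m v. length u = n}"
      using w y subtree_subset by (intro card_mono finite_subtree_level) blast
    finally show "Suc K \<le> \<dots>" .
  qed
qed

text \<open>Descent: non-trivial elements of \<open>Rist w2\<close> are not in
  \<open>Rist w1\<close>, so a finite \<open>Rist v\<close> would contain a strictly smaller finite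
  rigid stabiliser.\<close>

lemma rist_infinite:
  assumes "v \<in> V"
  shows "infinite (Rist v)"
  using assms
proof (induction "card (Rist v)" arbitrary: v rule: less_induct)
  case less
  show ?case
  proof
    assume fin: "finite (Rist v)"
    obtain w1 w2 where w: "w1 \<in> subtree m v" "w2 \<in> subtree m v" "w1 \<noteq> w2" "length w1 = length w2"
      using subtree_splits[OF \<open>v \<in> V\<close>] by blast
    have sub: "Rist w1 \<subseteq> Rist v" "Rist w2 \<subseteq> Rist v" using w rist_mono by blast+
    obtain g where g: "g \<in> Rist w2" "g \<noteq> id" using rist_nontrivial w subtree_vertices by blast
    then obtain u where u: "u \<in> subtree m w2" "g u \<noteq> u" using rist_moves by blast
    have "u \<notin> subtree m w1" using u w subtree_disjoint by blast
    then have "g \<notin> Rist w1" using u rist_fix by blast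
    then have "Rist w1 \<subset> Rist v" using sub g by blast
    then have "card (Rist w1) < card (Rist v)" using fin by (rule psubset_card_mono[rotated])
    from less(1)[OF this] have "infinite (Rist w1)" using w subtree_vertices by blast
    then show False using sub fin finite_subset by blast
  qed
qed

text \<open>If \<open>g\<close> moves \<open>w\<close>, distinct elements of the infinite group
  \<open>Rist w\<close> give distinct conjugates of \<open>g\<close>.\<close>

lemma conj_class_infinite:
  assumes "g \<in> G" "g \<noteq> id"
  shows "infinite ((\<lambda>h. h \<circ> g \<circ> inv h) ` G)"
proof
  assume fin: "finite ((\<lambda>h. h \<circ> g \<circ> inv h) ` G)"
  obtain w where w: "g w \<noteq> w" using assms by (metis eq_id_iff)
  then have wV: "w \<in> V" using tree_aut[OF assms(1)] by (auto simp: tree_aut_def)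
  have dis: "subtree m (g w) \<inter> subtree m w = {}" using moved_subtrees_disjoint assms w by blast
  have "inj_on (\<lambda>h. h \<circ> g \<circ> inv h) (Rist w)"
  proof (rule inj_onI)
    fix a b assume a: "a \<in> Rist w" and b: "b \<in> Rist w"
      and eq: "a \<circ> g \<circ> inv a = b \<circ> g \<circ> inv b"
    \<comment> \<open>On \<open>subtree m (g w)\<close> the conjugate is \<open>g (inv a (inv g u))\<close>, which determines \<open>a\<close> on \<open>subtree m w\<close>.\<close>
    have *: "(c \<circ> g \<circ> inv c) u = g (inv c u)" if "c \<in> Rist w" "u \<in> subtree m w" for c u
    proof -
      have "inv c u \<in> subtree m w" using that by simp
      then have "g (inv c u) \<in> subtree m (g w)" using assms wV by simp
      then have "g (inv c u) \<notin> subtree m w" using dis by blast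
      then show ?thesis using that by (simp add: rist_fix)
    qed
    have "inv a u = inv b u" for u
    proof (cases "u \<in> subtree m w")
      case True
      then have "g (inv a u) = g (inv b u)" using *[OF a True] *[OF b True] eq by simp
      then show ?thesis using assms by simp
    next
      case False then show ?thesis
        using rist_fix[OF rist_inv[OF a]] rist_fix[OF rist_inv[OF b]] by simp
    qed
    then have "inv a = inv b" by auto
    then show "a = b" using a b G_inv_inv rist_in_G by metis
  qed
  moreover have "finite ((\<lambda>h. h \<circ> g \<circ> inv h) ` Rist w)"
    using fin by (rule finite_subset[rotated]) (auto simp: rist_in_G)
  ultimately show False using rist_infinite[OF wV] finite_imageD by blast
qed

end

section \<open>Word growth and orbital growth\<close>

lemma word_ball_mono: "n \<le> k \<Longrightarrow> word_ball S n \<subseteq> word_ball S k"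
  by (auto simp: word_ball_def)

lemma id_in_word_ball: "id \<in> word_ball S n"
  by (auto simp: word_ball_def intro!: exI[of _ "[]"])

lemma foldr_comp_append: "foldr (\<circ>) (us @ vs) id = foldr (\<circ>) us id \<circ> foldr (\<circ>) vs id"
  by (induction us) (auto simp: o_assoc)

lemma word_ball_comp:
  assumes "a \<in> word_ball S n" "b \<in> word_ball S k"
  shows "a \<circ> b \<in> word_ball S (n + k)"
proof -
  obtain us where u: "a = foldr (\<circ>) us id" "set us \<subseteq> S" "length us \<le> n"
    using assms(1) by (auto simp: word_ball_def)
  obtain vs where v: "b = foldr (\<circ>) vs id" "set vs \<subseteq> S" "length vs \<le> k"
    using assms(2) by (auto simp: word_ball_def)
  show ?thesis unfolding word_ball_def
    using u v foldr_comp_append[of us vs]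
    by (intro CollectI exI[of _ "us @ vs"]) auto
qed

lemma word_ball_Suc_decomp:
  assumes "a \<in> word_ball S (Suc n)"
  shows "a = id \<or> (\<exists>s\<in>S. \<exists>b\<in>word_ball S n. a = s \<circ> b)"
proof -
  obtain us where u: "a = foldr (\<circ>) us id" "set us \<subseteq> S" "length us \<le> Suc n"
    using assms by (auto simp: word_ball_def)
  show ?thesis
  proof (cases us)
    case Nil then show ?thesis using u by simp
  next
    case (Cons s vs)
    have "foldr (\<circ>) vs id \<in> word_ball S n" using u Cons by (auto simp: word_ball_def)
    then show ?thesis using u Cons by auto
  qed
qed

lemma generator_in_word_ball: "s \<in> S \<Longrightarrow> s \<in> word_ball S 1"
  by (auto simp: word_ball_def intro!: exI[of _ "[s]"])

lemma finite_word_ball: "finite S \<Longrightarrow> finite (word_ball S n)"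
proof -
  assume "finite S"
  then have "finite {ws. set ws \<subseteq> S \<and> length ws \<le> n}" by (rule finite_lists_length_le)
  moreover have "word_ball S n = (\<lambda>ws. foldr (\<circ>) ws id) ` {ws. set ws \<subseteq> S \<and> length ws \<le> n}"
    by (auto simp: word_ball_def)
  ultimately show ?thesis by simp
qed

lemma card_le_fibres:
  fixes f :: "'a \<Rightarrow> 'b"
  assumes "finite A" and "\<And>t. t \<in> f ` A \<Longrightarrow> card {a\<in>A. f a = t} \<le> k"
  shows "card A \<le> k * card (f ` A)"
proof -
  have "card A = card (\<Union>t\<in>f ` A. {a\<in>A. f a = t})" by (rule arg_cong[of _ _ card]) auto
  also have "\<dots> \<le> (\<Sum>t\<in>f ` A. card {a\<in>A. f a = t})"
    using assms by (intro card_UN_le) auto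
  also have "\<dots> \<le> (\<Sum>t\<in>f ` A. k)" using assms by (intro sum_mono) auto
  finally show ?thesis by (simp add: mult.commute)
qed

section \<open>Growth of conjugacy classes and of rigid stabilisers inside word balls\<close>

locale fg_weakly_branch_group = weakly_branch_group +
  fixes S :: "(nat list \<Rightarrow> nat list) set"
  assumes gen: "fin_sym_gen_set G S"
begin

abbreviation "wball \<equiv> word_ball S"

lemma wball_in_G: "g \<in> wball n \<Longrightarrow> g \<in> G"
  using gen by (auto simp: fin_sym_gen_set_def)

lemma wball_exhausts: "g \<in> G \<Longrightarrow> \<exists>n. g \<in> wball n"
  using gen by (auto simp: fin_sym_gen_set_def)

lemma finite_wball: "finite (wball n)"
  using gen finite_word_ball by (auto simp: fin_sym_gen_set_def)

lemma wball_inv: "g \<in> wball n \<Longrightarrow> inv g \<in> wball n"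
proof (induction n arbitrary: g)
  case 0
  then show ?case by (auto simp: word_ball_def)
next
  case (Suc n)
  from word_ball_Suc_decomp[OF Suc.prems] show ?case
  proof
    assume "g = id" then show ?case using id_in_word_ball by (simp only: inv_id)
  next
    assume "\<exists>s\<in>S. \<exists>b\<in>wball n. g = s \<circ> b"
    then obtain s b where sb: "s \<in> S" "b \<in> wball n" "g = s \<circ> b" by blast
    have "inv s \<in> wball 1" using gen sb by (intro generator_in_word_ball) (simp add: fin_sym_gen_set_def)
    moreover have "inv b \<in> wball n" using Suc.IH sb by blast
    ultimately have "inv b \<circ> inv s \<in> wball (n + 1)" using word_ball_comp by blast
    moreover have "inv g = inv b \<circ> inv s"
      using sb wball_in_G generator_in_word_ball G_inv_comp by metis
    ultimately show ?case by (simp only: Suc_eq_plus1)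
  qed
qed

lemma finite_subset_wball: "finite A \<Longrightarrow> A \<subseteq> G \<Longrightarrow> \<exists>n. A \<subseteq> wball n"
proof (induction A rule: finite_induct)
  case empty
  then show ?case by blast
next
  case (insert a A)
  then obtain n k where "A \<subseteq> wball n" "a \<in> wball k" using wball_exhausts by blast
  then have "insert a A \<subseteq> wball (n + k)"
    using word_ball_mono[of n "n+k" S] word_ball_mono[of k "n+k" S] by auto
  then show ?case by blast
qed

text \<open>Enlarging the radius always produces a new conjugate: if this failed once it would fail
  for all larger radii, and the conjugacy class would be finite.\<close>

lemma conj_class_growth:
  assumes "g \<in> G" "g \<noteq> id"
  shows "n < card ((\<lambda>h. h \<circ> g \<circ> inv h) ` wball n)"
proof -
  define c where "c h = h \<circ> g \<circ> inv h" for h :: "nat list \<Rightarrow> nat list"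
  have comp: "c (h \<circ> k) = h \<circ> c k \<circ> inv h" if "h \<in> G" "k \<in> G" for h k
    using that by (simp add: c_def G_inv_comp o_assoc)
  have strict: "c ` wball n \<subset> c ` wball (Suc n)" for n
  proof -
    have sub: "c ` wball k \<subseteq> c ` wball (Suc k)" for k
      using word_ball_mono[of k "Suc k" S] by auto
    moreover have "c ` wball n \<noteq> c ` wball (Suc n)"
    proof
      assume eq: "c ` wball n = c ` wball (Suc n)"
      \<comment> \<open>A stationary step propagates: for \<open>h = s \<circ> b\<close> with
        \<open>c b = c b'\<close> and \<open>b'\<close> in the ball of radius \<open>n\<close>,
        \<open>c h\<close> equals \<open>c (s \<circ> b')\<close>, and \<open>s \<circ> b'\<close>
        has length at most \<open>Suc n\<close>.\<close>
      have "c ` wball k \<subseteq> c ` wball n" for k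
      proof (induction k)
        case 0
        then show ?case using word_ball_mono[of 0 n S] by auto
      next
        case (Suc k)
        show ?case
        proof
          fix a assume "a \<in> c ` wball (Suc k)"
          then obtain h where h: "h \<in> wball (Suc k)" "a = c h" by blast
          from word_ball_Suc_decomp[OF h(1)] show "a \<in> c ` wball n"
          proof
            assume "h = id" then show ?thesis using h id_in_word_ball by blast
          next
            assume "\<exists>s\<in>S. \<exists>b\<in>wball k. h = s \<circ> b"
            then obtain s b where sb: "s \<in> S" "b \<in> wball k" "h = s \<circ> b" by blast
            have sG: "s \<in> wball 1" using sb generator_in_word_ball by blast
            obtain b' where b': "b' \<in> wball n" "c b = c b'" using Suc sb by blast
            have "a = s \<circ> c b' \<circ> inv s" using h sb b' comp sG wball_in_G by metis
            also have "\<dots> = c (s \<circ> b')" using comp sG b' wball_in_G by metis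
            finally have "a = c (s \<circ> b')" .
            moreover have "s \<circ> b' \<in> wball (Suc n)"
              using word_ball_comp[OF sG b'(1)] by simp
            ultimately show ?thesis using eq by blast
          qed
        qed
      qed
      then have "c ` G \<subseteq> c ` wball n" using wball_exhausts by blast
      then have "finite (c ` G)" using finite_wball finite_subset by blast
      then show False using conj_class_infinite[OF assms] by (simp add: c_def)
    qed
    ultimately show ?thesis by blast
  qed
  have "n < card (c ` wball n)"
  proof (induction n)
    case 0
    have "c ` wball 0 \<noteq> {}" using id_in_word_ball by blast
    then show ?case using finite_wball by (simp add: card_gt_0_iff)
  next
    case (Suc n)
    have "card (c ` wball n) < card (c ` wball (Suc n))"
      using finite_wball strict by (intro psubset_card_mono) auto
    then show ?case using Suc by simp
  qed
  then show ?thesis by (simp add: c_def)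
qed

text \<open>Conjugating \<open>g\<close> by \<open>h\<close> leads into \<open>Rist (h v)\<close>,
  and one of finitely many fixed elements carries \<open>h v\<close> back to \<open>v\<close>. This
  costs bounded length and identifies only boundedly many conjugates.\<close>

lemma rist_linear_growth:
  assumes v: "v \<in> V"
  shows "\<exists>c. \<forall>n\<ge>1. \<exists>E. finite E \<and> E \<subseteq> Rist v \<inter> wball (c * n) \<and> n \<le> card E"
proof -
  obtain g where g: "g \<in> Rist v" "g \<noteq> id" using rist_nontrivial v by blast
  have gG: "g \<in> G" using g rist_in_G by blast
  define Lev where "Lev = tree_level m (length v)"
  define N where "N = card Lev"
  have fL: "finite Lev" by (simp add: Lev_def finite_tree_level)
  have "\<forall>w\<in>Lev. \<exists>t\<in>G. t w = v"
    using transitive v by (auto simp: Lev_def tree_level_def)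
  then obtain t where t: "\<And>w. w \<in> Lev \<Longrightarrow> t w \<in> G \<and> t w w = v" by metis
  obtain D where D: "t ` Lev \<subseteq> wball D" using finite_subset_wball[of "t ` Lev"] fL t by blast
  obtain l where l: "g \<in> wball l" using wball_exhausts gG by blast
  \<comment> \<open>Length budget: \<open>2 * D\<close> for \<open>t (h v)\<close> and its inverse,
    \<open>2 * N * n\<close> for \<open>h\<close> and its inverse, \<open>l\<close> for
    \<open>g\<close>; the constant terms are absorbed by \<open>n \<ge> 1\<close>.\<close>
  define c where "c = 2 * D + 2 * N + l"
  have "\<exists>E. finite E \<and> E \<subseteq> Rist v \<inter> wball (c * n) \<and> n \<le> card E" if "n \<ge> 1" for n
  proof -
    define E where "E = (\<lambda>h. t (h v) \<circ> (h \<circ> g \<circ> inv h) \<circ> inv (t (h v))) ` wball (N * n)"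
    define O' where "O' = (\<lambda>h. h \<circ> g \<circ> inv h) ` wball (N * n)"
    have hv: "h v \<in> Lev" if "h \<in> wball (N * n)" for h
      using v that wball_in_G by (auto simp: Lev_def tree_level_def)
    have finE: "finite E" by (simp add: E_def finite_wball)
    have "E \<subseteq> Rist v"
    proof
      fix e assume "e \<in> E"
      then obtain h where h: "h \<in> wball (N * n)" "e = t (h v) \<circ> (h \<circ> g \<circ> inv h) \<circ> inv (t (h v))"
        by (auto simp: E_def)
      have hG: "h \<in> G" using h wball_in_G by blast
      have "t (h v) \<circ> (h \<circ> g \<circ> inv h) \<circ> inv (t (h v)) \<in> Rist (t (h v) (h v))"
        using hG v t[OF hv[OF h(1)]] g by (intro rist_conj) auto
      then show "e \<in> Rist v" using h t[OF hv[OF h(1)]] by simp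
    qed
    moreover have "E \<subseteq> wball (c * n)"
    proof
      fix e assume "e \<in> E"
      then obtain h where h: "h \<in> wball (N * n)" "e = t (h v) \<circ> (h \<circ> g \<circ> inv h) \<circ> inv (t (h v))"
        by (auto simp: E_def)
      have "t (h v) \<in> wball D" using D hv[OF h(1)] by blast
      then have "e \<in> wball (D + (N * n + l + N * n) + D)"
        unfolding h(2) using h(1) l by (intro word_ball_comp wball_inv)
      moreover have "D + (N * n + l + N * n) + D \<le> c * n"
      proof -
        have "D + (N * n + l + N * n) + D = (2 * D + l) * 1 + 2 * N * n" by simp
        also have "\<dots> \<le> (2 * D + l) * n + 2 * N * n"
          using that by (intro add_mono mult_le_mono2) auto
        finally show ?thesis by (simp add: c_def add_mult_distrib)
      qed
      ultimately show "e \<in> wball (c * n)" using word_ball_mono by blast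
    qed
    moreover have "n \<le> card E"
    proof -
      \<comment> \<open>An element of \<open>E\<close> arises from at most \<open>N\<close>
        conjugates of \<open>g\<close>, one for each value of \<open>h v\<close>; the radius
        \<open>N * n\<close> makes up for this factor.\<close>
      have "O' \<subseteq> (\<Union>w\<in>Lev. (\<lambda>e. inv (t w) \<circ> e \<circ> t w) ` E)"
      proof
        fix o' assume "o' \<in> O'"
        then obtain h where h: "h \<in> wball (N * n)" "o' = h \<circ> g \<circ> inv h" by (auto simp: O'_def)
        define s where "s = t (h v)"
        have "s \<in> G" using t hv h by (simp add: s_def)
        then have "o' = inv s \<circ> (s \<circ> o' \<circ> inv s) \<circ> s" by (simp add: fun_eq_iff)
        moreover have "s \<circ> o' \<circ> inv s \<in> E" using h by (auto simp: E_def s_def)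
        ultimately show "o' \<in> (\<Union>w\<in>Lev. (\<lambda>e. inv (t w) \<circ> e \<circ> t w) ` E)"
          using hv[OF h(1)] unfolding s_def by blast
      qed
      then have "card O' \<le> card (\<Union>w\<in>Lev. (\<lambda>e. inv (t w) \<circ> e \<circ> t w) ` E)"
        using fL finE by (intro card_mono) auto
      also have "\<dots> \<le> (\<Sum>w\<in>Lev. card ((\<lambda>e. inv (t w) \<circ> e \<circ> t w) ` E))"
        by (rule card_UN_le[OF fL])
      also have "\<dots> \<le> (\<Sum>w\<in>Lev. card E)"
        using finE by (intro sum_mono card_image_le)
      finally have "card O' \<le> N * card E" by (simp add: N_def)
      moreover have "N * n < card O'" using conj_class_growth[OF gG g(2)] by (simp add: O'_def)
      ultimately have "N * n < N * card E" by linarith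
      then show ?thesis by simp
    qed
    ultimately show ?thesis using finE by blast
  qed
  then show ?thesis by blast
qed

text \<open>On the subtree at \<open>v\<close> the second factor is trivial, so \<open>a\<close> can
  be read off from the product.\<close>

lemma inj_on_rist_comp:
  assumes "subtree m v \<inter> subtree m w = {}"
  shows "inj_on (\<lambda>(a, b). a \<circ> b) (Rist v \<times> Rist w)"
proof (rule inj_onI, clarify)
  fix a b a' b' assume a: "a \<in> Rist v" "a' \<in> Rist v" and b: "b \<in> Rist w" "b' \<in> Rist w"
    and eq: "a \<circ> b = a' \<circ> b'"
  have 1: "a u = a' u" for u
  proof (cases "u \<in> subtree m v")
    case True
    then have "u \<notin> subtree m w" using assms by blast
    then show ?thesis using fun_cong[OF eq, of u] b by (simp add: rist_fix)
  next
    case False then show ?thesis using a by (simp add: rist_fix)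
  qed
  then have aa: "a = a'" by auto
  have "b u = b' u" for u
    using fun_cong[OF eq, of u] aa a rist_in_G by simp
  then show "a = a' \<and> b = b'" using aa by auto
qed

text \<open>Each induction step multiplies a set of linear size in \<open>Rist w1\<close> by one of
  size \<open>n ^ k\<close> in \<open>Rist w2\<close>. Disjoint supports keep the products distinct,
  while word lengths only add.\<close>

lemma rist_polynomial_growth:
  assumes v: "v \<in> V"
  shows "\<exists>c. \<forall>n\<ge>1. \<exists>E. finite E \<and> E \<subseteq> Rist v \<inter> wball (c * n) \<and> n ^ k \<le> card E"
  using v
proof (induction k arbitrary: v)
  case 0
  have "finite {id} \<and> {id} \<subseteq> Rist v \<inter> wball (0 * n) \<and> n ^ 0 \<le> card {id}" for n :: nat
    by (auto simp: id_in_word_ball)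
  then show ?case by blast
next
  case (Suc k)
  obtain w1 w2 where w: "w1 \<in> subtree m v" "w2 \<in> subtree m v" "w1 \<noteq> w2" "length w1 = length w2"
    using subtree_splits[OF \<open>v \<in> V\<close>] by blast
  have wV: "w1 \<in> V" "w2 \<in> V" using w subtree_vertices by blast+
  obtain c1 where c1: "\<And>n. n \<ge> 1 \<Longrightarrow> \<exists>E. finite E \<and> E \<subseteq> Rist w1 \<inter> wball (c1 * n) \<and> n \<le> card E"
    using rist_linear_growth[OF wV(1)] by blast
  obtain c2 where c2: "\<And>n. n \<ge> 1 \<Longrightarrow> \<exists>E. finite E \<and> E \<subseteq> Rist w2 \<inter> wball (c2 * n) \<and> n ^ k \<le> card E"
    using Suc.IH[OF wV(2)] by blast
  have "\<exists>E. finite E \<and> E \<subseteq> Rist v \<inter> wball ((c1 + c2) * n) \<and> n ^ Suc k \<le> card E"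
    if n: "n \<ge> 1" for n
  proof -
    obtain E1 where E1: "finite E1" "E1 \<subseteq> Rist w1 \<inter> wball (c1 * n)" "n \<le> card E1"
      using c1[OF n] by blast
    obtain E2 where E2: "finite E2" "E2 \<subseteq> Rist w2 \<inter> wball (c2 * n)" "n ^ k \<le> card E2"
      using c2[OF n] by blast
    define E where "E = (\<lambda>(a, b). a \<circ> b) ` (E1 \<times> E2)"
    have "inj_on (\<lambda>(a, b). a \<circ> b) (E1 \<times> E2)"
      using inj_on_rist_comp[OF subtree_disjoint[OF w(4,3)]] by (rule inj_on_subset) (use E1 E2 in blast)
    then have "card E = card E1 * card E2" by (simp add: E_def card_image card_cartesian_product)
    then have "n ^ Suc k \<le> card E" using E1(3) E2(3) by (simp add: mult_le_mono)
    moreover have "a \<circ> b \<in> Rist v \<inter> wball ((c1 + c2) * n)" if "a \<in> E1" "b \<in> E2" for a b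
    proof -
      have "a \<in> Rist v" "b \<in> Rist v" using that E1 E2 w rist_mono by blast+
      moreover have "a \<circ> b \<in> wball (c1 * n + c2 * n)" using that E1 E2 by (intro word_ball_comp) auto
      ultimately show ?thesis by (simp add: add_mult_distrib)
    qed
    then have "E \<subseteq> Rist v \<inter> wball ((c1 + c2) * n)" by (auto simp: E_def)
    moreover have "finite E" using E1 E2 by (simp add: E_def)
    ultimately show ?thesis by blast
  qed
  then show ?case by blast
qed

end

section \<open>Point stabilisers under polynomial orbital growth\<close>

locale small_growth_action = fg_weakly_branch_group m G S
  for m :: "nat \<Rightarrow> nat" and G S :: "(nat list \<Rightarrow> nat list) set" +
  fixes act :: "(nat list \<Rightarrow> nat list) \<Rightarrow> 'x::t2_space \<Rightarrow> 'x" and C d :: real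
  assumes action: "G_action G act" and minimal: "minimal_action G act"
    and faithful: "faithful_action G act"
    and C_pos: "C > 0"
    and growth: "\<And>n. n \<ge> 1 \<Longrightarrow> real (orbital_growth S act n) \<le> C * (C * real n) powr d"
begin

lemma act_id [simp]: "act id x = x"
  using action by (simp add: G_action_def)

lemma act_comp: "g \<in> G \<Longrightarrow> h \<in> G \<Longrightarrow> act (g \<circ> h) x = act g (act h x)"
  using action by (simp add: G_action_def)

lemma act_inv_left [simp]: "g \<in> G \<Longrightarrow> act (inv g) (act g x) = x"
  by (simp flip: act_comp)

lemma act_inv_right [simp]: "g \<in> G \<Longrightarrow> act g (act (inv g) x) = x"
  by (simp flip: act_comp)

definition stab :: "'x \<Rightarrow> (nat list \<Rightarrow> nat list) set" where
  "stab x = {g \<in> G. act g x = x}"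

lemma stab_in_G: "g \<in> stab x \<Longrightarrow> g \<in> G"
  by (auto simp: stab_def)

lemma stab_comp [simp]: "g \<in> stab x \<Longrightarrow> h \<in> stab x \<Longrightarrow> g \<circ> h \<in> stab x"
  by (auto simp: stab_def act_comp)

lemma stab_inv [simp]: "g \<in> stab x \<Longrightarrow> inv g \<in> stab x"
  by (auto simp: stab_def) (metis act_inv_left)

lemma stab_id [simp]: "id \<in> stab x"
  by (auto simp: stab_def)

lemma stab_conj_iff: "g \<in> G \<Longrightarrow> a \<in> G \<Longrightarrow> g \<circ> a \<circ> inv g \<in> stab (act g x) \<longleftrightarrow> a \<in> stab x"
  by (auto simp: stab_def act_comp) (metis act_inv_left)

text \<open>A supremum of naturals is an upper bound only for bounded families; here
  \<open>card (wball n)\<close> is the bound.\<close>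

lemma orbit_card_le: "card ((\<lambda>g. act g x) ` wball n) \<le> orbital_growth S act n"
proof -
  have "bdd_above (range (\<lambda>x. card ((\<lambda>g. act g x) ` wball n)))"
    by (rule bdd_aboveI[of _ "card (wball n)"]) (auto intro: card_image_le finite_wball)
  then show ?thesis unfolding orbital_growth_def by (intro cSUP_upper) auto
qed

text \<open>Pigeonhole: \<open>E\<close> has more elements than any \<open>x\<close> has images
  under it, so two elements agree at \<open>x\<close> and their quotient fixes \<open>x\<close>. As
  \<open>E\<close> is chosen independently of \<open>x\<close>, one finite set of quotients serves
  all points.\<close>

lemma rist_meets_stabs:
  assumes v: "v \<in> V"
  shows "\<exists>P. finite P \<and> P \<subseteq> Rist v - {id} \<and> (\<forall>x. P \<inter> stab x \<noteq> {})"
proof -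
  \<comment> \<open>With exponent at least \<open>d + 1\<close>, \<open>n ^ k\<close> exceeds
    \<open>M * n powr d\<close> as soon as \<open>n > M\<close>.\<close>
  define k where "k = Suc (nat \<lceil>d\<rceil>)"
  have k: "real k \<ge> d + 1" unfolding k_def by linarith
  obtain c where c: "\<And>n. n \<ge> 1 \<Longrightarrow> \<exists>E. finite E \<and> E \<subseteq> Rist v \<inter> wball (c * n) \<and> n ^ k \<le> card E"
    using rist_polynomial_growth[OF v, of k] by blast
  \<comment> \<open>\<open>M * n powr d\<close> is the growth bound at radius
    \<open>Suc c * n\<close>; \<open>Suc\<close> keeps this radius at least 1 even if
    \<open>c = 0\<close>.\<close>
  define M where "M = C * (C * real (Suc c)) powr d"
  define n where "n = Suc (nat \<lceil>M\<rceil>)"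
  have n: "n \<ge> 1" "real n > M" unfolding n_def by linarith+
  obtain E where E: "finite E" "E \<subseteq> Rist v \<inter> wball (c * n)" "n ^ k \<le> card E" using c n by blast
  have EG: "e \<in> G" if "e \<in> E" for e using that E rist_in_G by auto
  have lt: "card ((\<lambda>e. act e x) ` E) < card E" for x
  proof -
    have "c * n \<le> Suc c * n" by simp
    then have "E \<subseteq> wball (Suc c * n)" using E word_ball_mono by blast
    then have "card ((\<lambda>e. act e x) ` E) \<le> card ((\<lambda>e. act e x) ` wball (Suc c * n))"
      using finite_wball by (intro card_mono) auto
    also have "\<dots> \<le> orbital_growth S act (Suc c * n)" by (rule orbit_card_le)
    finally have "real (card ((\<lambda>e. act e x) ` E)) \<le> real (orbital_growth S act (Suc c * n))" by simp
    also have "\<dots> \<le> C * (C * real (Suc c * n)) powr d" using n by (intro growth) simp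
    also have "\<dots> = M * real n powr d"
      using C_pos by (simp add: M_def powr_mult del: of_nat_Suc mult_Suc)
    also have "\<dots> < real n * real n powr d" using n by simp
    also have "\<dots> = real n powr (d + 1)" using n by (simp add: powr_add)
    also have "\<dots> \<le> real n powr real k" using n k by (intro powr_mono) auto
    also have "\<dots> = real (n ^ k)" using n by (simp add: powr_realpow)
    also have "\<dots> \<le> real (card E)" using E(3) of_nat_le_iff by blast
    finally show ?thesis by simp
  qed
  define P where "P = {inv e \<circ> e' | e e'. e \<in> E \<and> e' \<in> E} - {id}"
  have "P \<subseteq> (\<lambda>(e, e'). inv e \<circ> e') ` (E \<times> E)" by (auto simp: P_def)
  then have "finite P" using E by (meson finite_SigmaI finite_imageI finite_subset)
  moreover have "P \<subseteq> Rist v - {id}"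
    unfolding P_def using E(2) rist_comp rist_inv by blast
  moreover have "P \<inter> stab x \<noteq> {}" for x
  proof -
    have "\<not> inj_on (\<lambda>e. act e x) E" using lt[of x] by (auto dest: card_image)
    then obtain e e' where e: "e \<in> E" "e' \<in> E" "e \<noteq> e'" "act e x = act e' x"
      by (auto simp: inj_on_def)
    have "inv e \<circ> e' \<in> stab x" using e EG by (simp add: stab_def act_comp) (metis act_inv_left)
    moreover have "inv e \<circ> e' \<noteq> id"
    proof
      assume "inv e \<circ> e' = id"
      then have "e \<circ> (inv e \<circ> e') = e" by simp
      then show False using e EG by (simp add: o_assoc)
    qed
    ultimately show ?thesis using e by (auto simp: P_def)
  qed
  ultimately show ?thesis by blast
qed

end

section \<open>Commutators in point stabilisers\<close>

text \<open>Greedy choice. Elements supported below the vertices \<open>u p\<close> will later act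
  trivially below every \<open>inv p (u p)\<close>, because no \<open>u j\<close> equals it.\<close>

lemma choose_separated:
  fixes U :: "('b \<Rightarrow> 'b) \<Rightarrow> 'b set"
  assumes "finite P" "\<And>p. p \<in> P \<Longrightarrow> inj p"
    and "\<And>p. p \<in> P \<Longrightarrow> 3 * card P < card (U p)"
    and "\<And>p u. p \<in> P \<Longrightarrow> u \<in> U p \<Longrightarrow> p u \<noteq> u"
  shows "\<exists>u. (\<forall>p\<in>P. u p \<in> U p) \<and> inj_on u P \<and> (\<forall>p\<in>P. \<forall>j\<in>P. p (u j) \<noteq> u p)"
proof -
  have "\<exists>u. (\<forall>p\<in>F. u p \<in> U p) \<and> inj_on u F \<and> (\<forall>p\<in>F. \<forall>j\<in>F. p (u j) \<noteq> u p)"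
    if "finite F" "F \<subseteq> P" for F
    using that
  proof (induction F rule: finite_induct)
    case empty
    then show ?case by simp
  next
    case (insert p0 F)
    obtain u where u: "\<And>p. p \<in> F \<Longrightarrow> u p \<in> U p" "inj_on u F"
      "\<And>p j. p \<in> F \<Longrightarrow> j \<in> F \<Longrightarrow> p (u j) \<noteq> u p"
      using insert by blast
    \<comment> \<open>The new point must avoid the earlier points, their images under
      \<open>p0\<close>, and the preimages of \<open>u p\<close> under \<open>p\<close>: at most
      \<open>card F\<close> values each.\<close>
    define bad where "bad = u ` F \<union> (\<lambda>j. p0 (u j)) ` F \<union> (\<lambda>p. inv p (u p)) ` F"
    have "card bad \<le> card (u ` F) + card ((\<lambda>j. p0 (u j)) ` F) + card ((\<lambda>p. inv p (u p)) ` F)"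
      unfolding bad_def by (meson add_le_mono card_Un_le le_trans order_refl)
    also have "\<dots> \<le> card F + card F + card F"
      using insert by (intro add_mono card_image_le)
    also have "\<dots> \<le> 3 * card P" using insert assms(1) card_mono[of P F] by simp
    also have "\<dots> < card (U p0)" using assms(3) insert by blast
    finally have "card bad < card (U p0)" .
    moreover have "finite bad" using insert by (simp add: bad_def)
    ultimately have "\<not> U p0 \<subseteq> bad" using card_mono by (metis not_le)
    then obtain y where y: "y \<in> U p0" "y \<notin> bad" by blast
    have p0: "p0 \<in> P" "p0 y \<noteq> y" using insert assms(4) y by blast+
    have inv: "p y \<noteq> u p" if "p \<in> F" for p
    proof
      assume "p y = u p"
      then have "y = inv p (u p)" using assms(2) that insert by (metis inv_f_f subsetD insertCI)
      then show False using y that by (auto simp: bad_def)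
    qed
    define u' where "u' = u(p0 := y)"
    have "inj_on u' (insert p0 F)"
      using u(2) y insert by (auto simp: u'_def inj_on_def bad_def)
    moreover have "\<forall>p\<in>insert p0 F. u' p \<in> U p"
      using u(1) y by (auto simp: u'_def)
    moreover have "p (u' j) \<noteq> u' p" if "p \<in> insert p0 F" "j \<in> insert p0 F" for p j
      using that u(3) y p0 inv insert by (auto simp: u'_def bad_def)
    ultimately show ?case by blast
  qed
  then show ?thesis using assms(1) by blast
qed

section \<open>Moved vertices, gluing, and subgroups of finite index\<close>

context weakly_branch_group
begin

lemma inj_G: "g \<in> G \<Longrightarrow> inj g"
  by (simp add: bij_G bij_is_inj)

text \<open>An element that moves \<open>w\<close> moves every vertex below \<open>w\<close>, and
  the deep levels below \<open>w\<close> are large.\<close>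

lemma many_moved:
  assumes "g \<in> Rist v" "g \<noteq> id"
  shows "\<exists>n0. \<forall>n\<ge>n0. K \<le> card {u \<in> subtree m v. length u = n \<and> g u \<noteq> u}"
proof -
  obtain w where w: "w \<in> subtree m v" "g w \<noteq> w" using rist_moves assms by blast
  have gG: "g \<in> G" using assms rist_in_G by blast
  have wV: "w \<in> V" using w subtree_vertices by blast
  obtain n0 where n0: "\<And>n. n \<ge> n0 \<Longrightarrow> K \<le> card {u \<in> subtree m w. length u = n}"
    using subtree_level_large[OF wV, of K] by blast
  have "K \<le> card {u \<in> subtree m v. length u = n \<and> g u \<noteq> u}" if "n \<ge> n0" for n
  proof -
    have "g u \<noteq> u" if "u \<in> subtree m w" for u
      using that moved_subtrees_disjoint[OF gG w(2)] G_subtree[OF gG wV, of u]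
      by (metis disjoint_iff)
    then have "{u \<in> subtree m w. length u = n} \<subseteq> {u \<in> subtree m v. length u = n \<and> g u \<noteq> u}"
      using subtree_subset[OF w(1)] by blast
    moreover have "finite {u \<in> subtree m v. length u = n \<and> g u \<noteq> u}"
      by (rule finite_subset[OF _ finite_subtree_level[of v n]]) auto
    ultimately show ?thesis using n0[OF that] card_mono le_trans by blast
  qed
  then show ?thesis by blast
qed

text \<open>The element is the product of the \<open>c p\<close>; their supports are disjoint since
  the \<open>u p\<close> are distinct vertices of one level.\<close>

lemma glue:
  assumes "finite F" "inj_on u F" "\<And>p. p \<in> F \<Longrightarrow> length (u p) = n"
    "\<And>p. p \<in> F \<Longrightarrow> c p \<in> Rist (u p)"
  shows "\<exists>a\<in>G. (\<forall>p\<in>F. \<forall>y\<in>subtree m (u p). a y = c p y)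
    \<and> (\<forall>y. (\<forall>p\<in>F. y \<notin> subtree m (u p)) \<longrightarrow> a y = y)"
  using assms
proof (induction F rule: finite_induct)
  case empty
  then show ?case by (intro bexI[of _ id]) auto
next
  case (insert p0 F)
  obtain a where a: "a \<in> G" "\<And>p y. p \<in> F \<Longrightarrow> y \<in> subtree m (u p) \<Longrightarrow> a y = c p y"
    "\<And>y. \<forall>p\<in>F. y \<notin> subtree m (u p) \<Longrightarrow> a y = y"
    using insert.IH insert.prems by (auto simp: inj_on_def)
  have c0: "c p0 \<in> Rist (u p0)" using insert by simp
  have dis: "subtree m (u p0) \<inter> subtree m (u p) = {}" if "p \<in> F" for p
    using that insert by (intro subtree_disjoint) (auto simp: inj_on_def)
  have "a \<circ> c p0 \<in> G" using a(1) rist_in_G[OF c0] by simp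
  moreover have "(a \<circ> c p0) y = c p y" if p: "p \<in> insert p0 F" and y: "y \<in> subtree m (u p)" for p y
  proof (cases "p = p0")
    case True
    have "c p0 y \<in> subtree m (u p0)" using c0 y True by simp
    then have "a (c p0 y) = c p0 y" using dis by (intro a(3)) blast
    then show ?thesis using True by simp
  next
    case False
    then have "p \<in> F" using p by blast
    then have "y \<notin> subtree m (u p0)" using dis y by blast
    then show ?thesis using \<open>p \<in> F\<close> y c0 a(2) by (simp add: rist_fix)
  qed
  moreover have "(a \<circ> c p0) y = y" if "\<forall>p\<in>insert p0 F. y \<notin> subtree m (u p)" for y
    using that c0 a(3) by (simp add: rist_fix)
  ultimately show ?case by blast
qed

text \<open>Finite index of \<open>Q\<close> is expressed by \<open>\<phi>\<close>: finitely many
  values, and equal values only within one coset. If every vertex below \<open>w0\<close> had a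
  commutator outside \<open>Q\<close>, three vertices with equal data would yield two elements of
  \<open>Q\<close> whose commutator is one of those excluded.\<close>

lemma finite_index_contains_commutators:
  assumes Q: "Q \<subseteq> Rist v" "\<And>a b. a \<in> Q \<Longrightarrow> b \<in> Q \<Longrightarrow> a \<circ> b \<in> Q" "\<And>a. a \<in> Q \<Longrightarrow> inv a \<in> Q"
    and \<phi>: "finite (\<phi> ` Rist v)"
      "\<And>a b. a \<in> Rist v \<Longrightarrow> b \<in> Rist v \<Longrightarrow> \<phi> a = \<phi> b \<Longrightarrow> a \<circ> inv b \<in> Q"
    and w0: "w0 \<in> subtree m v"
  shows "\<exists>w\<in>subtree m w0. \<forall>a\<in>Rist w. \<forall>b\<in>Rist w. commutator a b \<in> Q"
proof (rule ccontr)
  assume "\<not> ?thesis"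
  then have "\<forall>w\<in>subtree m w0. \<exists>a\<in>Rist w. \<exists>b\<in>Rist w. commutator a b \<notin> Q" by blast
  then obtain a b where ab: "\<And>w. w \<in> subtree m w0 \<Longrightarrow> a w \<in> Rist w"
    "\<And>w. w \<in> subtree m w0 \<Longrightarrow> b w \<in> Rist w"
    "\<And>w. w \<in> subtree m w0 \<Longrightarrow> commutator (a w) (b w) \<notin> Q"
    by metis
  define T where "T = \<phi> ` Rist v \<times> \<phi> ` Rist v"
  \<comment> \<open>More than \<open>2 * card T\<close> vertices force three with the same values.
    Two would not do: the factors of both entries at the second vertex need not commute.\<close>
  obtain n where n: "2 * card T + 1 \<le> card {u \<in> subtree m w0. length u = n}"
    using subtree_level_large[of w0 "2 * card T + 1"] w0 subtree_vertices by blast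
  define A where "A = {u \<in> subtree m w0. length u = n}"
  define f where "f w = (\<phi> (a w), \<phi> (b w))" for w
  have finA: "finite A" by (simp add: A_def finite_subtree_level)
  have inR: "a w \<in> Rist v" "b w \<in> Rist v" if "w \<in> A" for w
    using that ab(1,2) w0 subtree_subset rist_mono unfolding A_def by blast+
  have "f ` A \<subseteq> T" using inR by (auto simp: f_def T_def)
  then have cT: "card (f ` A) \<le> card T" using \<phi>(1) by (intro card_mono) (auto simp: T_def)
  have "\<exists>t\<in>f ` A. 3 \<le> card {u\<in>A. f u = t}"
  proof (rule ccontr)
    assume "\<not> ?thesis"
    then have "card {u\<in>A. f u = t} \<le> 2" if "t \<in> f ` A" for t using that by force
    then have "card A \<le> 2 * card (f ` A)" by (rule card_le_fibres[OF finA])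
    then show False using n cT by (simp add: A_def)
  qed
  then obtain t where "3 \<le> card {u\<in>A. f u = t}" by blast
  then obtain X where X: "X \<subseteq> {u\<in>A. f u = t}" "card X = 3" by (meson obtain_subset_with_card_n)
  then obtain i j l where ijl: "X = {i, j, l}" "i \<noteq> j" "i \<noteq> l" "j \<noteq> l"
    by (auto simp: card_3_iff)
  have A: "i \<in> A" "j \<in> A" "l \<in> A" and feq: "f i = f j" "f i = f l" using X ijl by auto
  have q: "a i \<circ> inv (a j) \<in> Q" "b i \<circ> inv (b l) \<in> Q"
    using A feq inR by (auto simp: f_def intro!: \<phi>(2))
  have sub: "i \<in> subtree m w0" "j \<in> subtree m w0" "l \<in> subtree m w0"
    and len: "length i = n" "length j = n" "length l = n" using A by (auto simp: A_def)
  have R: "a i \<in> Rist i" "b i \<in> Rist i" "inv (a i) \<in> Rist i" "inv (b i) \<in> Rist i"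
      "a j \<in> Rist j" "inv (a j) \<in> Rist j" "b l \<in> Rist l" "inv (b l) \<in> Rist l"
    using ab sub by auto
  have dis: "subtree m i \<inter> subtree m j = {}" "subtree m i \<inter> subtree m l = {}"
      "subtree m j \<inter> subtree m l = {}"
    using ijl len by (auto intro!: subtree_disjoint)
  \<comment> \<open>The factors at \<open>j\<close> and \<open>l\<close> commute with all the others
    and cancel against their inverses.\<close>
  have "commutator (a i \<circ> inv (a j)) (b i \<circ> inv (b l)) = commutator (a i) (b i)"
  proof
    fix y
    have inv1: "inv (a i \<circ> inv (a j)) = a j \<circ> inv (a i)" "inv (b i \<circ> inv (b l)) = b l \<circ> inv (b i)"
      using R rist_in_G by (simp_all add: G_inv_comp)
    have cj: "inv (a j) (h y) = h (inv (a j) y)" if "h \<in> Rist i" for h y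
      using rist_commute[OF R(6) that] dis by blast
    have cjl: "inv (a j) (inv (b l) y) = inv (b l) (inv (a j) y)" for y
      using rist_commute[OF R(6) R(8)] dis by blast
    have cl: "inv (b l) (h y) = h (inv (b l) y)" if "h \<in> Rist i" for h y
      using rist_commute[OF R(8) that] dis by blast
    have g: "a j \<in> G" "b l \<in> G" using R rist_in_G by auto
    have "commutator (a i \<circ> inv (a j)) (b i \<circ> inv (b l)) y
        = a i (inv (a j) (b i (inv (b l) (a j (inv (a i) (b l (inv (b i) y)))))))"
      by (simp add: commutator_def inv1)
    also have "\<dots> = a i (b i (inv (b l) (inv (a j) (a j (inv (a i) (b l (inv (b i) y)))))))"
      by (simp only: cj[OF R(2)] cjl)
    also have "\<dots> = a i (b i (inv (a i) (inv (b l) (b l (inv (b i) y)))))"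
      using g by (simp add: cl[OF R(3)])
    also have "\<dots> = commutator (a i) (b i) y"
      using g by (simp add: commutator_def)
    finally show "commutator (a i \<circ> inv (a j)) (b i \<circ> inv (b l)) y = commutator (a i) (b i) y" .
  qed
  moreover have "commutator (a i \<circ> inv (a j)) (b i \<circ> inv (b l)) \<in> Q"
    using q Q(2,3) by (simp add: commutator_def)
  ultimately show False using ab(3) sub by simp
qed

section \<open>Commutators and double commutators of rigid stabilisers\<close>

definition comm :: "nat list \<Rightarrow> (nat list \<Rightarrow> nat list) set" where
  "comm v = {commutator a b | a b. a \<in> Rist v \<and> b \<in> Rist v}"

text \<open>The set L(v) of the introductory comment. Taking the elements instead of the subgroup
  they generate makes no difference for inclusion in a stabiliser.\<close>

definition dcomm :: "nat list \<Rightarrow> (nat list \<Rightarrow> nat list) set" where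
  "dcomm v = {commutator a b | a b. a \<in> comm v \<and> b \<in> comm v}"

lemma comm_subset_rist: "comm v \<subseteq> Rist v"
  by (auto simp: comm_def)

lemma dcomm_subset_rist: "dcomm v \<subseteq> Rist v"
  using comm_subset_rist by (auto simp: dcomm_def) (meson rist_commutator subsetD)

lemma dcomm_in_G: "a \<in> dcomm v \<Longrightarrow> a \<in> G"
  using dcomm_subset_rist rist_in_G by blast

lemma comm_mono: "w \<in> subtree m v \<Longrightarrow> comm w \<subseteq> comm v"
  using rist_mono by (fastforce simp: comm_def)

lemma dcomm_mono: "w \<in> subtree m v \<Longrightarrow> dcomm w \<subseteq> dcomm v"
  using comm_mono by (fastforce simp: dcomm_def)

lemma commutator_conj:
  assumes "g \<in> G" "a \<in> G" "b \<in> G"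
  shows "g \<circ> commutator a b \<circ> inv g = commutator (g \<circ> a \<circ> inv g) (g \<circ> b \<circ> inv g)"
  using assms by (simp add: fun_eq_iff commutator_def G_inv_comp)

lemma comm_conj: "g \<in> G \<Longrightarrow> v \<in> V \<Longrightarrow> a \<in> comm v \<Longrightarrow> g \<circ> a \<circ> inv g \<in> comm (g v)"
  unfolding comm_def using commutator_conj rist_conj rist_in_G by blast

lemma dcomm_conj: "g \<in> G \<Longrightarrow> v \<in> V \<Longrightarrow> a \<in> dcomm v \<Longrightarrow> g \<circ> a \<circ> inv g \<in> dcomm (g v)"
  unfolding dcomm_def using commutator_conj comm_conj comm_subset_rist rist_in_G by blast

text \<open>Below \<open>w\<close> the commutator acts as \<open>inv b\<close>: \<open>inv a\<close>
  carries points out of the subtree at \<open>w\<close>, where \<open>b\<close> is trivial, and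
  \<open>a\<close> brings them back.\<close>

lemma commutator_nontrivial:
  assumes "a \<in> G" "a w \<noteq> w" "b \<in> Rist w" "b \<noteq> id"
  shows "commutator a b \<noteq> id"
proof
  assume eq: "commutator a b = id"
  have "w \<in> V" using assms tree_aut[of a] by (auto simp: tree_aut_def)
  obtain y where y: "y \<in> subtree m w" "b y \<noteq> y" using assms rist_moves by blast
  have "inv a w \<noteq> w" using assms by (metis G_inv_right)
  then have dis: "subtree m (inv a w) \<inter> subtree m w = {}"
    using assms moved_subtrees_disjoint[of "inv a"] by simp
  have "inv b y \<in> subtree m w" using assms y by simp
  then have "inv a (inv b y) \<in> subtree m (inv a w)" using assms \<open>w \<in> V\<close> by simp
  then have "inv a (inv b y) \<notin> subtree m w" using dis by blast
  then have "commutator a b y = inv b y"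
    using assms by (simp add: commutator_def rist_fix)
  then have "inv b y = y" using eq by simp
  then show False using y assms rist_in_G by (metis G_inv_right)
qed

lemma comm_nontrivial:
  assumes "v \<in> V"
  shows "\<exists>a\<in>comm v. a \<noteq> id"
proof -
  obtain a where a: "a \<in> Rist v" "a \<noteq> id" using rist_nontrivial assms by blast
  obtain w where w: "w \<in> subtree m v" "a w \<noteq> w" using a rist_moves by blast
  obtain b where b: "b \<in> Rist w" "b \<noteq> id" using rist_nontrivial w subtree_vertices by blast
  have "b \<in> Rist v" using b w rist_mono by blast
  then have "commutator a b \<in> comm v" using a by (auto simp: comm_def)
  then show ?thesis using commutator_nontrivial a w b rist_in_G by blast
qed

lemma dcomm_nontrivial:
  assumes "v \<in> V"
  shows "\<exists>a\<in>dcomm v. a \<noteq> id"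
proof -
  obtain a where a: "a \<in> comm v" "a \<noteq> id" using comm_nontrivial assms by blast
  have aR: "a \<in> Rist v" using a comm_subset_rist by blast
  obtain w where w: "w \<in> subtree m v" "a w \<noteq> w" using a aR rist_moves by blast
  obtain b where b: "b \<in> comm w" "b \<noteq> id" using comm_nontrivial w subtree_vertices by blast
  have "b \<in> comm v" using b w comm_mono by blast
  then have "commutator a b \<in> dcomm v" using a by (auto simp: dcomm_def)
  then show ?thesis using commutator_nontrivial aR w b comm_subset_rist rist_in_G by blast
qed

end

section \<open>Restrictions of point stabilisers to subtrees\<close>

context small_growth_action
begin

text \<open>The group Q of the introductory comment. The witness \<open>z\<close> is unconstrained
  outside the subtree at \<open>u\<close>.\<close>

definition local_stab :: "'x \<Rightarrow> nat list \<Rightarrow> (nat list \<Rightarrow> nat list) set" where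
  "local_stab x u = {c \<in> Rist u. \<exists>z\<in>stab x. \<forall>y\<in>subtree m u. z y = c y}"

lemma local_stab_comp:
  assumes "a \<in> local_stab x u" "b \<in> local_stab x u"
  shows "a \<circ> b \<in> local_stab x u"
proof -
  obtain z where z: "z \<in> stab x" "\<forall>y\<in>subtree m u. z y = a y" "a \<in> Rist u"
    using assms by (auto simp: local_stab_def)
  obtain z' where z': "z' \<in> stab x" "\<forall>y\<in>subtree m u. z' y = b y" "b \<in> Rist u"
    using assms by (auto simp: local_stab_def)
  have "\<forall>y\<in>subtree m u. (z \<circ> z') y = (a \<circ> b) y" using z z' by simp
  then show ?thesis using z z' stab_comp rist_comp unfolding local_stab_def by blast
qed

lemma local_stab_inv:
  assumes "a \<in> local_stab x u"
  shows "inv a \<in> local_stab x u"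
proof -
  obtain z where z: "z \<in> stab x" "\<forall>y\<in>subtree m u. z y = a y" "a \<in> Rist u"
    using assms by (auto simp: local_stab_def)
  have "inv z y = inv a y" if "y \<in> subtree m u" for y
  proof -
    have "inv a y \<in> subtree m u" using z that by simp
    then have "z (inv a y) = y" using z rist_in_G by simp
    then show ?thesis using z stab_in_G by (metis G_inv_left)
  qed
  then show ?thesis using z stab_inv rist_inv unfolding local_stab_def by blast
qed

text \<open>The sets counted are right cosets of \<open>local_stab x u\<close> in
  \<open>Rist u\<close>; representatives of infinitely many cosets would form the excluded
  sequence.\<close>

lemma finite_index_if_no_infinite_transversal:
  assumes "\<nexists>c::nat \<Rightarrow> nat list \<Rightarrow> nat list. range c \<subseteq> Rist u \<and>
      (\<forall>s t. s \<noteq> t \<longrightarrow> c s \<circ> inv (c t) \<notin> local_stab x u)"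
  shows "finite ((\<lambda>a. {b \<in> Rist u. a \<circ> inv b \<in> local_stab x u}) ` Rist u)" (is "finite (?f ` _)")
proof (rule ccontr)
  assume "infinite (?f ` Rist u)"
  then obtain e :: "nat \<Rightarrow> _" where e: "inj e" "range e \<subseteq> ?f ` Rist u"
    using infinite_countable_subset by blast
  then have "\<forall>s. \<exists>a. a \<in> Rist u \<and> e s = ?f a" by blast
  from choice[OF this] obtain c where c: "\<And>s. c s \<in> Rist u" "\<And>s. e s = ?f (c s)" by blast
  have "c s \<circ> inv (c t) \<notin> local_stab x u" if "s \<noteq> t" for s t
  proof
    assume st: "c s \<circ> inv (c t) \<in> local_stab x u"
    have G: "c s \<in> G" "c t \<in> G" using c rist_in_G by blast+
    have ts: "c t \<circ> inv (c s) \<in> local_stab x u"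
      using local_stab_inv[OF st] G by (simp add: G_inv_comp)
    have "c t \<circ> inv b \<in> local_stab x u \<longleftrightarrow> c s \<circ> inv b \<in> local_stab x u" for b
    proof
      assume "c t \<circ> inv b \<in> local_stab x u"
      from local_stab_comp[OF st this] show "c s \<circ> inv b \<in> local_stab x u"
        using G by (simp add: comp_def)
    next
      assume "c s \<circ> inv b \<in> local_stab x u"
      from local_stab_comp[OF ts this] show "c t \<circ> inv b \<in> local_stab x u"
        using G by (simp add: comp_def)
    qed
    then have "e s = e t" using c by simp
    then show False using e that by (auto dest: injD)
  qed
  then show False using assms c(1) by blast
qed

text \<open>If \<open>a\<close> and \<open>b\<close> are conjugated with the same \<open>p\<close> into the stabiliser of \<open>x\<close>, then
  \<open>z = (a p a\<^sup>-\<^sup>1) (b p b\<^sup>-\<^sup>1)\<^sup>-\<^sup>1\<close> fixes \<open>x\<close>, and \<open>z\<close> acts as \<open>a b\<^sup>-\<^sup>1\<close> below any vertex \<open>u\<close> such that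
  \<open>a\<close> and \<open>b\<close> are trivial below \<open>p\<^sup>-\<^sup>1 u\<close>.\<close>

lemma local_stab_finite_index:
  assumes v: "v \<in> V"
  shows "\<exists>u\<in>subtree m v. finite ((\<lambda>a. {b \<in> Rist u. a \<circ> inv b \<in> local_stab x u}) ` Rist u)"
proof -
  obtain P where P: "finite P" "P \<subseteq> Rist v - {id}" "\<And>x. P \<inter> stab x \<noteq> {}"
    using rist_meets_stabs[OF v] by blast
  have PG: "p \<in> G" if "p \<in> P" for p using that P rist_in_G by blast
  define K where "K = Suc (3 * card P)"
  have "\<forall>p\<in>P. \<exists>n0. \<forall>n\<ge>n0. K \<le> card {u \<in> subtree m v. length u = n \<and> p u \<noteq> u}"
    using P many_moved by blast
  from bchoice[OF this] obtain n0 where n0: "\<And>p n. p \<in> P \<Longrightarrow> n \<ge> n0 p \<Longrightarrow>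
      K \<le> card {u \<in> subtree m v. length u = n \<and> p u \<noteq> u}" by blast
  \<comment> \<open>One level on which every \<open>p\<close> moves more than
    \<open>3 * card P\<close> vertices, as \<open>choose_separated\<close> requires.\<close>
  define n where "n = Max (n0 ` P)"
  define U where "U p = {u \<in> subtree m v. length u = n \<and> p u \<noteq> u}" for p
  have "\<exists>u. (\<forall>p\<in>P. u p \<in> U p) \<and> inj_on u P \<and> (\<forall>p\<in>P. \<forall>j\<in>P. p (u j) \<noteq> u p)"
  proof (rule choose_separated)
    fix p assume p: "p \<in> P"
    then have "n0 p \<le> n" using P by (simp add: n_def)
    from n0[OF p this] show "3 * card P < card (U p)" by (simp add: U_def K_def)
    show "inj p" using inj_G PG p by blast
  qed (use P in \<open>auto simp: U_def\<close>)
  then obtain u where u: "\<And>p. p \<in> P \<Longrightarrow> u p \<in> U p" "inj_on u P"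
    "\<And>p j. p \<in> P \<Longrightarrow> j \<in> P \<Longrightarrow> p (u j) \<noteq> u p" by blast
  have ulen: "length (u p) = n" and usub: "u p \<in> subtree m v" and uV: "u p \<in> V" if "p \<in> P" for p
    using u(1)[OF that] subtree_vertices by (auto simp: U_def)
  show ?thesis
  proof (rule ccontr)
    assume neg: "\<not> ?thesis"
    \<comment> \<open>If no \<open>u p\<close> works, each admits a sequence of elements in pairwise
      distinct cosets. For every index \<open>s\<close> the elements \<open>c p s\<close> are then
      glued into a single \<open>a s\<close>.\<close>
    have "\<exists>c::nat \<Rightarrow> nat list \<Rightarrow> nat list. range c \<subseteq> Rist (u p) \<and>
        (\<forall>s t. s \<noteq> t \<longrightarrow> c s \<circ> inv (c t) \<notin> local_stab x (u p))" if "p \<in> P" for p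
      using finite_index_if_no_infinite_transversal[of "u p" x] neg usub[OF that] by blast
    then have "\<forall>p\<in>P. \<exists>c::nat \<Rightarrow> nat list \<Rightarrow> nat list. range c \<subseteq> Rist (u p) \<and>
        (\<forall>s t. s \<noteq> t \<longrightarrow> c s \<circ> inv (c t) \<notin> local_stab x (u p))" by blast
    from bchoice[OF this] obtain c :: "(nat list \<Rightarrow> nat list) \<Rightarrow> nat \<Rightarrow> nat list \<Rightarrow> nat list"
      where c: "\<And>p s. p \<in> P \<Longrightarrow> c p s \<in> Rist (u p)"
        "\<And>p s t. p \<in> P \<Longrightarrow> s \<noteq> t \<Longrightarrow> c p s \<circ> inv (c p t) \<notin> local_stab x (u p)"
      by blast
    have "\<forall>s. \<exists>a\<in>G. (\<forall>p\<in>P. \<forall>y\<in>subtree m (u p). a y = c p s y)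
        \<and> (\<forall>y. (\<forall>p\<in>P. y \<notin> subtree m (u p)) \<longrightarrow> a y = y)"
      using glue[OF P(1) u(2) ulen] c(1) by simp
    then obtain a where a: "\<And>s. a s \<in> G"
      "\<And>s p y. p \<in> P \<Longrightarrow> y \<in> subtree m (u p) \<Longrightarrow> a s y = c p s y"
      "\<And>s y. \<forall>p\<in>P. y \<notin> subtree m (u p) \<Longrightarrow> a s y = y" by metis
    \<comment> \<open>\<open>P\<close> meets the stabiliser of each translate
      \<open>act (inv (a s)) x\<close>; being finite, it supplies the same \<open>p\<close> for two
      indices.\<close>
    have "\<forall>s. \<exists>p. p \<in> P \<and> p \<in> stab (act (inv (a s)) x)" using P(3) by blast
    then obtain \<pi> where \<pi>: "\<And>s. \<pi> s \<in> P" "\<And>s. \<pi> s \<in> stab (act (inv (a s)) x)" by metis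
    have "\<not> inj \<pi>"
      using P(1) \<pi>(1) by (meson finite_subset infinite_UNIV_nat finite_imageD image_subsetI)
    then obtain s t where st: "s \<noteq> t" "\<pi> s = \<pi> t" by (auto simp: inj_def)
    define p where "p = \<pi> s"
    have p: "p \<in> P" "p \<in> G" using \<pi> PG by (auto simp: p_def)
    have conj: "a r \<circ> p \<circ> inv (a r) \<in> stab x" if "p \<in> stab (act (inv (a r)) x)" for r
      using stab_conj_iff[of "a r" p "act (inv (a r)) x"] a(1) p that by simp
    define z where "z = (a s \<circ> p \<circ> inv (a s)) \<circ> inv (a t \<circ> p \<circ> inv (a t))"
    have z: "z \<in> stab x"
      unfolding z_def using \<pi>(2)[of s] \<pi>(2)[of t] st by (intro stab_comp stab_inv conj) (auto simp: p_def)
    have zy: "z y = (c p s \<circ> inv (c p t)) y" if y: "y \<in> subtree m (u p)" for y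
    proof -
      have y': "inv (c p t) y \<in> subtree m (u p)" using c(1) p y by simp
      then have "a t (inv (c p t) y) = y"
        using a(2)[OF p(1) y'] G_inv_right[OF rist_in_G[OF c(1)[OF p(1), of t]]] by simp
      then have ia: "inv (a t) y = inv (c p t) y" using a(1) by (metis G_inv_left)
      \<comment> \<open>\<open>y1\<close> lies below \<open>inv p (u p)\<close>, which is none of
        the chosen \<open>u j\<close>, so every \<open>a r\<close> fixes it.\<close>
      define y1 where "y1 = inv p (inv (c p t) y)"
      have y1: "y1 \<in> subtree m (inv p (u p))"
        using y' p uV by (simp add: y1_def)
      have "y1 \<notin> subtree m (u j)" if "j \<in> P" for j
      proof -
        have "inv p (u p) \<noteq> u j" using u(3)[OF p(1) that] p(2) by (metis G_inv_right)
        then have "subtree m (inv p (u p)) \<inter> subtree m (u j) = {}"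
          using p that ulen by (intro subtree_disjoint) auto
        then show ?thesis using y1 by blast
      qed
      then have fix1: "a r y1 = y1" for r using a(3) by blast
      then have fix2: "inv (a r) y1 = y1" for r using a(1) by (metis G_inv_left)
      have "z y = a s (p (inv (a s) (a t (inv p (inv (a t) y)))))"
        using a(1) p by (simp add: z_def G_inv_comp)
      also have "\<dots> = a s (p y1)" using fix1 fix2 by (simp add: ia flip: y1_def)
      also have "\<dots> = a s (inv (c p t) y)" using p by (simp add: y1_def)
      also have "\<dots> = c p s (inv (c p t) y)" using a(2) p y' by blast
      finally show ?thesis by simp
    qed
    have "c p s \<circ> inv (c p t) \<in> Rist (u p)" using c(1) p by simp
    then have "c p s \<circ> inv (c p t) \<in> local_stab x (u p)"
      using z zy by (auto simp: local_stab_def)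
    then show False using c(2) p st by blast
  qed
qed

text \<open>\<open>z\<close> preserves the subtree at \<open>u\<close>, as it agrees with
  \<open>c\<close> there; off this subtree \<open>h\<close> is trivial, so \<open>z\<close> cancels
  against its inverse.\<close>

lemma commutator_local:
  assumes h: "h \<in> Rist u" and c: "c \<in> Rist u" and z: "z \<in> G" "\<And>y. y \<in> subtree m u \<Longrightarrow> z y = c y"
  shows "commutator h z = commutator h c"
proof
  fix y
  have cG: "c \<in> G" "h \<in> G" using c h rist_in_G by auto
  have iz: "inv z y = inv c y" if "y \<in> subtree m u" for y
  proof -
    have "inv c y \<in> subtree m u" using c that by simp
    then have "z (inv c y) = y" using z cG by simp
    then show ?thesis using z by (metis G_inv_left)
  qed
  show "commutator h z y = commutator h c y"
  proof (cases "y \<in> subtree m u")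
    case True
    have "inv c y \<in> subtree m u" "inv h (inv c y) \<in> subtree m u" using True c h by auto
    then show ?thesis using True z iz by (simp add: commutator_def)
  next
    case False
    have "inv z y \<notin> subtree m u"
    proof
      assume "inv z y \<in> subtree m u"
      moreover from this have "z (inv z y) = c (inv z y)" by (rule z(2))
      ultimately have "z (inv z y) \<in> subtree m u" using c by simp
      then show False using G_inv_right[OF z(1)] False by simp
    qed
    then have "commutator h z y = h (z (inv z y))"
      using rist_fix[OF rist_inv[OF h]] by (simp add: commutator_def)
    moreover have "commutator h c y = y"
      using False h c rist_fix[OF rist_inv[OF h]] rist_fix[OF rist_inv[OF c]]
      by (simp add: commutator_def rist_fix)
    ultimately show ?thesis using False z h by (simp add: rist_fix)
  qed
qed

text \<open>Double commutator trick. By \<open>commutator_local\<close>, elements of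
  \<open>stab x\<close> may replace \<open>inv c\<close> and \<open>c'\<close> in commutators with
  elements of \<open>Rist u\<close>; and since \<open>h\<close> moves \<open>w0\<close>,
  \<open>commutator h (inv c)\<close> acts as \<open>c\<close> below \<open>w0\<close>.\<close>

lemma stab_contains_dcomm:
  assumes v: "v \<in> V"
  shows "\<exists>w\<in>subtree m v. dcomm w \<subseteq> stab x"
proof -
  obtain u where u: "u \<in> subtree m v"
    "finite ((\<lambda>a. {b \<in> Rist u. a \<circ> inv b \<in> local_stab x u}) ` Rist u)"
    using local_stab_finite_index[OF v] by blast
  have uV: "u \<in> V" using u subtree_vertices by blast
  \<comment> \<open>Applied to \<open>u\<close> and not to \<open>v\<close>, so that
    \<open>h\<close> is supported where \<open>local_stab x u\<close> gives control.\<close>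
  obtain P where "P \<subseteq> Rist u - {id}" "P \<inter> stab x \<noteq> {}"
    using rist_meets_stabs[OF uV] by blast
  then obtain h where h: "h \<in> Rist u" "h \<noteq> id" "h \<in> stab x" by blast
  obtain w0 where w0: "w0 \<in> subtree m u" "h w0 \<noteq> w0" using h rist_moves by blast
  have w0V: "w0 \<in> V" using w0 subtree_vertices by blast
  have hG: "h \<in> G" using h rist_in_G by blast
  have "\<exists>w\<in>subtree m w0. \<forall>a\<in>Rist w. \<forall>b\<in>Rist w. commutator a b \<in> local_stab x u"
  proof (rule finite_index_contains_commutators[OF _ _ _ u(2) _ w0(1)])
    show "local_stab x u \<subseteq> Rist u" by (auto simp: local_stab_def)
    fix a b assume ab: "a \<in> Rist u" "b \<in> Rist u"
      "{b \<in> Rist u. a \<circ> inv b \<in> local_stab x u} = {b' \<in> Rist u. b \<circ> inv b' \<in> local_stab x u}"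
    have "id \<in> local_stab x u" unfolding local_stab_def by (auto intro!: bexI[of _ id])
    then have "b \<in> {b' \<in> Rist u. b \<circ> inv b' \<in> local_stab x u}" using ab rist_in_G by simp
    then show "a \<circ> inv b \<in> local_stab x u" using ab by blast
  qed (auto intro: local_stab_comp local_stab_inv)
  then obtain w where w: "w \<in> subtree m w0" "comm w \<subseteq> local_stab x u"
    by (auto simp: comm_def)
  have "commutator c c' \<in> stab x" if c: "c \<in> comm w" "c' \<in> comm w" for c c'
  proof -
    \<comment> \<open>The inverse makes \<open>commutator h e\<close> end in the factor
      \<open>c\<close> itself.\<close>
    define e where "e = inv c"
    have "c \<in> Rist w0" "c' \<in> Rist w0"
      using c comm_subset_rist rist_mono[OF w(1)] by blast+
    then have R: "c \<in> Rist w0" "c' \<in> Rist w0" "e \<in> Rist w0" by (auto simp: e_def)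
    have Ru: "c' \<in> Rist u" "e \<in> Rist u" using R rist_mono[OF w0(1)] by blast+
    have GG: "c \<in> G" "c' \<in> G" "e \<in> G" using R rist_in_G by auto
    have "e \<in> local_stab x u" unfolding e_def using c w by (intro local_stab_inv) blast
    then obtain z where z: "z \<in> stab x" "\<And>y. y \<in> subtree m u \<Longrightarrow> z y = e y"
      by (auto simp: local_stab_def)
    obtain z' where z': "z' \<in> stab x" "\<And>y. y \<in> subtree m u \<Longrightarrow> z' y = c' y"
      using c w by (auto simp: local_stab_def)
    define k where "k = commutator h e"
    have zG: "z \<in> G" "z' \<in> G" using z z' stab_in_G by auto
    have kst: "k \<in> stab x"
      using commutator_local[OF h(1) Ru(2) zG(1) z(2)] h(3) z(1)
      by (simp add: k_def) (metis commutator_def stab_comp stab_inv)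
    have kR: "k \<in> Rist u" using h Ru by (simp add: k_def)
    have "commutator k z' \<in> stab x"
      using kst z' by (simp add: commutator_def)
    then have 1: "commutator k c' \<in> stab x"
      using commutator_local[OF kR Ru(1) zG(2) z'(2)] by simp
    \<comment> \<open>\<open>k\<close> is the product of \<open>inv e = c\<close> and an element supported below \<open>h w0\<close>.\<close>
    define f where "f = h \<circ> e \<circ> inv h"
    have f: "f \<in> Rist (h w0)" unfolding f_def using hG w0V R by (intro rist_conj)
    have dis: "subtree m (h w0) \<inter> subtree m w0 = {}" using moved_subtrees_disjoint hG w0 by blast
    have k: "k = f \<circ> c" using GG by (simp add: k_def f_def commutator_def e_def)
    have fc: "f (g y) = g (f y)" if "g \<in> Rist w0" for g y
      using rist_commute[OF f that dis] .
    have fG: "f \<in> G" using f rist_in_G by blast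
    have "commutator k c' = commutator c c'"
    proof
      fix y
      have "commutator k c' y = f (c (c' (inv c (inv f (inv c' y)))))"
        using k fG GG by (simp add: commutator_def G_inv_comp)
      also have "\<dots> = c (c' (inv c (f (inv f (inv c' y)))))"
        using R by (simp add: fc)
      also have "\<dots> = commutator c c' y" using fG by (simp add: commutator_def)
      finally show "commutator k c' y = commutator c c' y" .
    qed
    then show ?thesis using 1 by simp
  qed
  then have "dcomm w \<subseteq> stab x" by (auto simp: dcomm_def)
  moreover have "w \<in> subtree m v" using w w0 u subtree_subset by blast
  ultimately show ?thesis by blast
qed

end

section \<open>The map to closed sets of rays\<close>

lemma bdist_le:
  assumes "map \<xi> [0..<n] = map \<eta> [0..<n]"
  shows "bdist \<xi> \<eta> \<le> (1/2) ^ n"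
proof (cases "\<xi> = \<eta>")
  case False
  then obtain j where "\<xi> j \<noteq> \<eta> j" by blast
  then have "\<xi> (LEAST k. \<xi> k \<noteq> \<eta> k) \<noteq> \<eta> (LEAST k. \<xi> k \<noteq> \<eta> k)" by (rule LeastI)
  then have "n \<le> (LEAST k. \<xi> k \<noteq> \<eta> k)" using assms by (auto simp: not_less[symmetric])
  then show ?thesis using False by (simp add: bdist_def power_decreasing)
qed (simp add: bdist_def)

lemma bdist_nonneg: "0 \<le> bdist \<xi> \<eta>"
  by (simp add: bdist_def)

lemma one_sided_hausdorff_le:
  assumes "A \<noteq> {}" "\<And>\<xi>. \<xi> \<in> A \<Longrightarrow> \<exists>\<eta>\<in>B. map \<xi> [0..<n] = map \<eta> [0..<n]"
  shows "(SUP a\<in>A. INF b\<in>B. bdist a b) \<le> (1/2) ^ n"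
proof (rule cSUP_least[OF assms(1)])
  fix \<xi> assume "\<xi> \<in> A"
  then obtain \<eta> where "\<eta> \<in> B" "map \<xi> [0..<n] = map \<eta> [0..<n]" using assms(2) by blast
  moreover have "bdd_below (bdist \<xi> ` B)" using bdist_nonneg by (intro bdd_belowI2[of _ 0])
  ultimately show "(INF b\<in>B. bdist \<xi> b) \<le> (1/2) ^ n"
    using bdist_le by (meson cINF_lower2)
qed

lemma bdist_commute: "bdist \<xi> \<eta> = bdist \<eta> \<xi>"
  by (simp add: bdist_def eq_commute)

text \<open>Each ray of either set has a partner in the other sharing \<open>n\<close> letters,
  which bounds both one-sided distances.\<close>

lemma hausdorff_dist_le:
  assumes "A \<noteq> {}" "B \<noteq> {}" "(\<lambda>\<xi>. map \<xi> [0..<n]) ` A = (\<lambda>\<xi>. map \<xi> [0..<n]) ` B"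
  shows "hausdorff_dist A B \<le> (1/2) ^ n"
proof -
  have match: "\<exists>\<eta>\<in>Y. map \<xi> [0..<n] = map \<eta> [0..<n]"
    if "(\<lambda>\<xi>. map \<xi> [0..<n]) ` X = (\<lambda>\<xi>. map \<xi> [0..<n]) ` Y" "\<xi> \<in> X"
    for X Y :: "(nat \<Rightarrow> nat) set" and \<xi>
    using imageI[OF that(2), of "\<lambda>\<xi>. map \<xi> [0..<n]"] unfolding that(1) by (simp only: image_iff)
  have "(SUP a\<in>A. INF b\<in>B. bdist a b) \<le> (1/2) ^ n"
    by (rule one_sided_hausdorff_le[OF assms(1) match[OF assms(3)]])
  moreover have "(SUP b\<in>B. INF a\<in>A. bdist b a) \<le> (1/2) ^ n"
    by (rule one_sided_hausdorff_le[OF assms(2) match[OF assms(3)[symmetric]]])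
  ultimately show ?thesis using assms by (simp add: hausdorff_dist_def bdist_commute)
qed

definition rays :: "(nat \<Rightarrow> nat) \<Rightarrow> (nat \<Rightarrow> nat) set" where
  "rays m = {\<xi>. \<forall>k. \<xi> k < m k}"

lemma prefix_in_tree: "\<xi> \<in> rays m \<Longrightarrow> map \<xi> [0..<n] \<in> tree_vertices m"
  by (auto simp: rays_def tree_vertices_def)

lemma take_prefix: "k \<le> n \<Longrightarrow> take k (map \<xi> [0..<n]) = map \<xi> [0..<k]"
  by (simp add: take_map)

lemma prefix_in_subtree:
  "\<xi> \<in> rays m \<Longrightarrow> k \<le> n \<Longrightarrow> map \<xi> [0..<n] \<in> subtree m (map \<xi> [0..<k])"
  by (auto simp: subtree_def prefix_in_tree take_prefix)

text \<open>The hypothesis makes the complement a union of cylinders, which are basic open sets of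
  the product topology.\<close>

lemma closedin_boundary:
  assumes "A \<subseteq> rays m"
    and "\<And>\<xi>. \<xi> \<in> rays m \<Longrightarrow> \<xi> \<notin> A \<Longrightarrow>
      \<exists>n. \<forall>\<eta>\<in>rays m. map \<eta> [0..<n] = map \<xi> [0..<n] \<longrightarrow> \<eta> \<notin> A"
  shows "closedin (boundary_top m) A"
proof -
  have top: "topspace (boundary_top m) = rays m"
    by (auto simp: boundary_top_def rays_def PiE_def)
  have "openin (boundary_top m) (rays m - A)"
  proof (subst openin_subopen, safe)
    fix \<xi> assume \<xi>: "\<xi> \<in> rays m" "\<xi> \<notin> A"
    obtain n where n: "\<And>\<eta>. \<eta> \<in> rays m \<Longrightarrow> map \<eta> [0..<n] = map \<xi> [0..<n] \<Longrightarrow> \<eta> \<notin> A"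
      using assms(2)[OF \<xi>] by blast
    define T where "T = (\<Pi>\<^sub>E k\<in>UNIV. if k < n then {\<xi> k} else {..<m k})"
    have "openin (boundary_top m) T"
      unfolding boundary_top_def T_def
    proof (rule product_topology_basis)
      show "finite {i. (if i < n then {\<xi> i} else {..<m i}) \<noteq> topspace (discrete_topology {..<m i})}"
        by (rule finite_subset[of _ "{..<n}"]) (auto split: if_splits)
    qed (use \<xi> in \<open>auto simp: rays_def\<close>)
    moreover have "\<xi> \<in> T" using \<xi> by (auto simp: T_def rays_def)
    moreover have "T \<subseteq> rays m - A"
    proof
      fix \<eta> assume "\<eta> \<in> T"
      then have T: "\<eta> k \<in> (if k < n then {\<xi> k} else {..<m k})" for k
        by (auto simp: T_def PiE_def Pi_def)
      have "\<eta> k < m k" for k using T[of k] \<xi> by (auto simp: rays_def split: if_splits)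
      then have "\<eta> \<in> rays m" by (simp add: rays_def)
      moreover have "map \<eta> [0..<n] = map \<xi> [0..<n]" 
      proof (rule map_cong[OF refl])
        fix k assume "k \<in> set [0..<n]"
        then show "\<eta> k = \<xi> k" using T[of k] by simp
      qed
      ultimately show "\<eta> \<in> rays m - A" using n by blast
    qed
    ultimately show "\<exists>T. openin (boundary_top m) T \<and> \<xi> \<in> T \<and> T \<subseteq> rays m - A" by blast
  qed
  then show ?thesis using assms(1) by (simp add: closedin_def top)
qed

section \<open>The action on rays\<close>

context weakly_branch_group
begin

text \<open>The letters of \<open>ray_act g \<xi>\<close> come from images of different prefixes;
  they fit together because \<open>g\<close> commutes with \<open>take\<close>.\<close>

lemma ray_act_prefix:
  assumes "g \<in> G" "\<xi> \<in> rays m"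
  shows "map (ray_act g \<xi>) [0..<n] = g (map \<xi> [0..<n])"
proof (rule nth_equalityI)
  fix k assume "k < length (map (ray_act g \<xi>) [0..<n])"
  then have k: "k < n" by simp
  have "ray_act g \<xi> k = g (take (Suc k) (map \<xi> [0..<n])) ! k"
    using k by (simp only: ray_act_def take_prefix Suc_leI)
  also have "\<dots> = g (map \<xi> [0..<n]) ! k"
    using assms prefix_in_tree by (simp add: G_take)
  finally show "map (ray_act g \<xi>) [0..<n] ! k = g (map \<xi> [0..<n]) ! k" using k by simp
qed (use assms in simp)

lemma ray_act_in_rays:
  assumes "g \<in> G" "\<xi> \<in> rays m"
  shows "ray_act g \<xi> \<in> rays m"
proof -
  have "ray_act g \<xi> k < m k" for k
  proof -
    have "g (map \<xi> [0..<Suc k]) \<in> V" using assms prefix_in_tree by (simp del: upt_Suc)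
    then show ?thesis using assms
      unfolding ray_act_def tree_vertices_def by (simp del: upt_Suc)
  qed
  then show ?thesis by (simp add: rays_def)
qed

lemma ray_act_inv:
  assumes "g \<in> G" "\<xi> \<in> rays m"
  shows "ray_act g (ray_act (inv g) \<xi>) = \<xi>"
proof
  fix k
  have "ray_act g (ray_act (inv g) \<xi>) k = g (inv g (map \<xi> [0..<Suc k])) ! k"
    unfolding ray_act_def[of g] using ray_act_prefix[of "inv g" \<xi> "Suc k"] assms by (simp del: upt_Suc)
  also have "\<dots> = \<xi> k" using assms by (simp del: upt_Suc)
  finally show "ray_act g (ray_act (inv g) \<xi>) k = \<xi> k" .
qed

end

section \<open>Clopen sets from minimality, and the vertices on bad rays\<close>

context small_growth_action
begin

lemma closed_fixed_points: "g \<in> G \<Longrightarrow> closed {x. act g x = x}"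
  using action by (intro closed_Collect_eq) (auto simp: G_action_def continuous_on_id)

lemma closed_invariant_is_UNIV:
  assumes "closed D" "x \<in> D" "\<And>g y. g \<in> G \<Longrightarrow> y \<in> D \<Longrightarrow> act g y \<in> D"
  shows "D = UNIV"
proof -
  have "closure ((\<lambda>g. act g x) ` G) \<subseteq> D" using assms by (intro closure_minimal) auto
  then show ?thesis using minimal by (auto simp: minimal_action_def)
qed

text \<open>The set of \<open>y\<close> lying in at least \<open>k\<close> of the sets is closed and invariant, so by minimality
  every point lies in the same number of them; hence the family of sets containing \<open>y\<close>, which
  is upper semicontinuous in \<open>y\<close>, is locally constant.\<close>

lemma equivariant_closed_imp_open:
  assumes cl: "\<And>v. v \<in> tree_level m n \<Longrightarrow> closed (A v)"
    and eq: "\<And>g v y. g \<in> G \<Longrightarrow> v \<in> tree_level m n \<Longrightarrow> y \<in> A v \<Longrightarrow> act g y \<in> A (g v)"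
    and v: "v \<in> tree_level m n"
  shows "open (A v)"
proof -
  define L where "L = tree_level m n"
  define J where "J y = {v\<in>L. y \<in> A v}" for y
  have fL: "finite L" by (simp add: L_def finite_tree_level)
  have fJ: "finite (J y)" for y using fL by (simp add: J_def)
  define I where "I X = (\<Inter>w\<in>X. A w)" for X
  have clI: "closed (I X)" if "X \<subseteq> L" for X
    unfolding I_def using cl that by (intro closed_INT) (auto simp: L_def)
  have inI: "y \<in> I X \<longleftrightarrow> X \<subseteq> J y" if "X \<subseteq> L" for X y using that by (auto simp: I_def J_def)
  have le: "card (J x) \<le> card (J y)" for x y
  proof -
    define D where "D = (\<Union>X\<in>{X. X \<subseteq> L \<and> card X = card (J x)}. I X)"
    have D: "y \<in> D \<longleftrightarrow> card (J x) \<le> card (J y)" for y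
    proof
      assume "y \<in> D"
      then obtain X where "X \<subseteq> J y" "card X = card (J x)" using inI by (auto simp: D_def)
      then show "card (J x) \<le> card (J y)" using fJ by (metis card_mono)
    next
      assume "card (J x) \<le> card (J y)"
      then obtain X where X: "X \<subseteq> J y" "card X = card (J x)" by (meson obtain_subset_with_card_n)
      then have "X \<subseteq> L" by (auto simp: J_def)
      then show "y \<in> D" using X inI by (auto simp: D_def)
    qed
    have "closed D"
      unfolding D_def using fL clI by (intro closed_UN) auto
    moreover have "x \<in> D" by (simp add: D)
    moreover have "act g y \<in> D" if "g \<in> G" "y \<in> D" for g y
    proof -
      have "g ` J y \<subseteq> J (act g y)"
        using that(1) eq by (auto simp: J_def L_def tree_level_def)
      moreover have "card (g ` J y) = card (J y)"
        using that(1) inj_G by (meson card_image inj_on_subset subset_UNIV)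
      ultimately have "card (J y) \<le> card (J (act g y))" using fJ by (metis card_mono)
      then show ?thesis using that(2) by (simp add: D)
    qed
    ultimately have "D = UNIV" by (rule closed_invariant_is_UNIV)
    then show ?thesis using D by blast
  qed
  \<comment> \<open>All \<open>J y\<close> have the same size, so \<open>y\<close> avoids
    \<open>A v\<close> exactly if it lies in \<open>I X\<close> for some \<open>X\<close> of that
    size without \<open>v\<close>. \<open>undefined\<close> is an arbitrary point that names the
    size.\<close>
  have "- A v = (\<Union>X\<in>{X. X \<subseteq> L \<and> v \<notin> X \<and> card X = card (J undefined)}. I X)"
  proof safe
    fix y assume "y \<notin> A v"
    then have "J y \<subseteq> L" "v \<notin> J y" "card (J y) = card (J undefined)"
      using le[of y undefined] le[of undefined y] by (auto simp: J_def)
    then show "y \<in> (\<Union>X\<in>{X. X \<subseteq> L \<and> v \<notin> X \<and> card X = card (J undefined)}. I X)"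
      using inI by blast
  next
    fix y X assume X: "X \<subseteq> L" "v \<notin> X" "card X = card (J undefined)" and y: "y \<in> I X" "y \<in> A v"
    have "X \<subseteq> J y" using X y inI by blast
    then have "X = J y" using fJ le[of y undefined] X by (intro card_seteq) auto
    then show False using X y v by (auto simp: J_def L_def)
  qed
  moreover have "closed (\<Union>X\<in>{X. X \<subseteq> L \<and> v \<notin> X \<and> card X = card (J undefined)}. I X)"
    using fL clI by (intro closed_UN) auto
  ultimately show ?thesis by (simp add: open_closed)
qed

lemma dcomm_stab_equivariant:
  assumes "g \<in> G" "w \<in> V"
  shows "dcomm (g w) \<subseteq> stab (act g x) \<longleftrightarrow> dcomm w \<subseteq> stab x"
proof -
  have *: "dcomm w \<subseteq> stab x" if "g \<in> G" "w \<in> V" "dcomm (g w) \<subseteq> stab (act g x)" for g w x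
  proof
    fix a assume a: "a \<in> dcomm w"
    then have "g \<circ> a \<circ> inv g \<in> stab (act g x)" using dcomm_conj that by blast
    then show "a \<in> stab x" using stab_conj_iff that(1) a dcomm_in_G by blast
  qed
  show ?thesis using *[OF assms] *[of "inv g" "g w" "act g x"] assms by auto
qed

lemma open_fix_dcomm:
  assumes "w \<in> V"
  shows "open {x. dcomm w \<subseteq> stab x}"
proof (rule equivariant_closed_imp_open[where A = "\<lambda>w. {x. dcomm w \<subseteq> stab x}"])
  show "w \<in> tree_level m (length w)" using assms by (simp add: tree_level_def)
  show "closed {x. dcomm v \<subseteq> stab x}" for v
  proof -
    have "{x. dcomm v \<subseteq> stab x} = (\<Inter>a\<in>dcomm v. {x. act a x = x})"
      using dcomm_in_G by (auto simp: stab_def)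
    then show ?thesis using closed_fixed_points dcomm_in_G by auto
  qed
qed (auto simp: dcomm_stab_equivariant tree_level_def)

text \<open>Otherwise, by equivariance, a non-trivial element of \<open>dcomm w\<close> would fix
  the whole orbit of \<open>x\<close>, which is dense, and so act trivially against
  faithfulness.\<close>

lemma not_all_fixed:
  "\<exists>w\<in>V. length w = n \<and> \<not> dcomm w \<subseteq> stab x"
proof (rule ccontr)
  assume neg: "\<not> ?thesis"
  obtain w where w: "w \<in> V" "length w = n"
    using extend_to_level[of "[]" n] by (auto simp: subtree_def tree_vertices_def)
  obtain a where a: "a \<in> dcomm w" "a \<noteq> id" using dcomm_nontrivial w by blast
  have aG: "a \<in> G" using a dcomm_in_G by blast
  have orbit: "act a (act g x) = act g x" if g: "g \<in> G" for g
  proof -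
    have "dcomm (inv g w) \<subseteq> stab x" using neg w g by simp
    then have "dcomm w \<subseteq> stab (act g x)"
      using dcomm_stab_equivariant[of g "inv g w" x] g w by simp
    then show ?thesis using a by (auto simp: stab_def)
  qed
  have "closure ((\<lambda>g. act g x) ` G) \<subseteq> {y. act a y = y}"
    using orbit closed_fixed_points[OF aG] by (intro closure_minimal) auto
  then have "act a y = y" for y using minimal by (auto simp: minimal_action_def)
  then have "act a = id" by auto
  then show False using faithful aG a by (auto simp: faithful_action_def)
qed

text \<open>By Koenig's lemma these are the vertices on bad rays. Stated level by level, the
  condition is an intersection of conditions on finitely many vertices each, which suits
  topology.\<close>

definition persistent :: "'x \<Rightarrow> nat list \<Rightarrow> bool" where
  "persistent x v \<longleftrightarrow> v \<in> V \<and>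
     (\<forall>n\<ge>length v. \<exists>w\<in>subtree m v. length w = n \<and> \<not> dcomm w \<subseteq> stab x)"

text \<open>The map q of the introductory comment.\<close>

definition bad_rays :: "'x \<Rightarrow> (nat \<Rightarrow> nat) set" where
  "bad_rays x = {\<xi> \<in> rays m. \<forall>n. \<not> dcomm (map \<xi> [0..<n]) \<subseteq> stab x}"

lemma persistent_root: "persistent x []"
  using not_all_fixed by (auto simp: persistent_def subtree_def tree_vertices_def)

lemma persistent_imp_not_fixed:
  assumes "persistent x v"
  shows "\<not> dcomm v \<subseteq> stab x"
proof -
  obtain w where "w \<in> subtree m v" "length w = length v" "\<not> dcomm w \<subseteq> stab x"
    using assms unfolding persistent_def by blast
  then show ?thesis by (auto simp: subtree_def)
qed

text \<open>Once \<open>dcomm w' \<subseteq> stab x\<close> holds, it holds for all vertices below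
  \<open>w'\<close>. So if each of the finitely many children fails on some level, all fail on the
  largest of these levels, and so does \<open>v\<close>.\<close>

lemma persistent_child:
  assumes "persistent x v"
  shows "\<exists>k. persistent x (v @ [k])"
proof (rule ccontr)
  assume neg: "\<not> ?thesis"
  define M where "M = {k. k < m (length v)}"
  have vV: "v \<in> V" using assms by (simp add: persistent_def)
  have childV: "v @ [k] \<in> V" if "k \<in> M" for k
    using that vV by (auto simp: tree_vertices_def M_def nth_append less_Suc_eq)
  have "\<forall>k\<in>M. \<exists>n. n \<ge> Suc (length v) \<and> (\<forall>w\<in>subtree m (v @ [k]). length w = n \<longrightarrow> dcomm w \<subseteq> stab x)"
  proof
    fix k assume "k \<in> M"
    then show "\<exists>n. n \<ge> Suc (length v) \<and> (\<forall>w\<in>subtree m (v @ [k]). length w = n \<longrightarrow> dcomm w \<subseteq> stab x)"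
      using neg childV[of k] unfolding persistent_def by auto
  qed
  from bchoice[OF this] obtain n where n: "\<And>k. k \<in> M \<Longrightarrow> n k \<ge> Suc (length v)"
    "\<And>k w. k \<in> M \<Longrightarrow> w \<in> subtree m (v @ [k]) \<Longrightarrow> length w = n k \<Longrightarrow> dcomm w \<subseteq> stab x" by blast
  define N where "N = Max (insert (Suc (length v)) (n ` M))"
  have fM: "finite M" by (simp add: M_def)
  have N: "Suc (length v) \<le> N" "\<And>k. k \<in> M \<Longrightarrow> n k \<le> N" using fM by (auto simp: N_def)
  obtain w where w: "w \<in> subtree m v" "length w = N" "\<not> dcomm w \<subseteq> stab x"
    using assms N(1) by (auto simp: persistent_def dest!: spec[of _ N])
  define k where "k = w ! length v"
  have k: "k \<in> M" using w N(1) by (auto simp: k_def M_def subtree_def tree_vertices_def)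
  define w' where "w' = take (n k) w"
  have wV: "w \<in> V" using w subtree_vertices by blast
  have "take (Suc (length v)) w = v @ [k]"
    using w N(1) by (simp add: take_Suc_conv_app_nth k_def subtree_def)
  then have "w' \<in> subtree m (v @ [k])" "length w' = n k"
    using n(1)[OF k] N(2)[OF k] w wV by (auto simp: w'_def subtree_def take_tree_vertices min_def)
  then have "dcomm w' \<subseteq> stab x" using n(2) k by blast
  moreover have "w \<in> subtree m w'"
    using wV N(2)[OF k] w by (simp add: w'_def subtree_def)
  ultimately show False using w(3) dcomm_mono by blast
qed

lemma persistent_imp_ray:
  assumes "persistent x v"
  shows "\<exists>\<xi>\<in>bad_rays x. map \<xi> [0..<length v] = v"
proof -
  have "\<exists>f. \<forall>i. (persistent x (f i) \<and> (i = 0 \<longrightarrow> f i = v)) \<and> (\<exists>k. f (Suc i) = f i @ [k])"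
    using assms persistent_child by (intro dependent_nat_choice) (blast, fastforce)
  then obtain f where f: "\<And>i. persistent x (f i)" "f 0 = v" "\<And>i. \<exists>k. f (Suc i) = f i @ [k]"
    by blast
  have len: "length (f i) = length v + i" for i
  proof (induction i)
    case (Suc i) then show ?case using f(3)[of i] by auto
  qed (use f in simp)
  have coh: "f j ! k = f i ! k" if "i \<le> j" "k < length (f i)" for i j k
    using that
  proof (induction j rule: dec_induct)
    case (step j)
    then show ?case using f(3)[of j] len by (auto simp: nth_append)
  qed simp
  \<comment> \<open>\<open>f (Suc k)\<close> has length at least \<open>Suc k\<close>, so its letter
    at position \<open>k\<close> exists.\<close>
  define \<xi> where "\<xi> k = f (Suc k) ! k" for k
  have pre: "map \<xi> [0..<n] = take n (f j)" if "n \<le> length (f j)" for n j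
  proof (rule nth_equalityI)
    fix k assume "k < length (map \<xi> [0..<n])"
    then have k: "k < n" by simp
    have "f (Suc k) ! k = f j ! k"
      using coh[of "Suc k" j k] coh[of j "Suc k" k] k that len by (cases "j \<le> Suc k") auto
    then show "map \<xi> [0..<n] ! k = take n (f j) ! k" using k by (simp add: \<xi>_def)
  qed (use that in simp)
  have fV: "f i \<in> V" for i using f(1) by (simp add: persistent_def)
  have "\<xi> k < m k" for k
    using fV[of "Suc k"] len by (simp add: \<xi>_def tree_vertices_def)
  then have ray: "\<xi> \<in> rays m" by (simp add: rays_def)
  have "\<not> dcomm (map \<xi> [0..<n]) \<subseteq> stab x" for n
  proof -
    have n: "n \<le> length (f n)" by (simp add: len)
    have "f n \<in> subtree m (map \<xi> [0..<n])" using fV n by (simp add: pre subtree_def)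
    then show ?thesis using persistent_imp_not_fixed[OF f(1)[of n]] dcomm_mono by blast
  qed
  then have "\<xi> \<in> bad_rays x" using ray by (simp add: bad_rays_def)
  moreover have "map \<xi> [0..<length v] = v" using pre[of "length v" 0] f(2) by simp
  ultimately show ?thesis by blast
qed

lemma bad_ray_persistent:
  assumes "\<xi> \<in> bad_rays x"
  shows "persistent x (map \<xi> [0..<n])"
  unfolding persistent_def
proof (intro conjI allI impI)
  have ray: "\<xi> \<in> rays m" using assms by (simp add: bad_rays_def)
  then show "map \<xi> [0..<n] \<in> V" by (rule prefix_in_tree)
  fix k assume "k \<ge> length (map \<xi> [0..<n])"
  then have "map \<xi> [0..<k] \<in> subtree m (map \<xi> [0..<n])" using ray by (intro prefix_in_subtree) auto
  then show "\<exists>w\<in>subtree m (map \<xi> [0..<n]). length w = k \<and> \<not> dcomm w \<subseteq> stab x"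
    using assms by (intro bexI[of _ "map \<xi> [0..<k]"]) (auto simp: bad_rays_def)
qed

text \<open>Reduces Hausdorff closeness of values of \<open>bad_rays\<close> to equality of finite
  sets of persistent vertices.\<close>

lemma prefixes_of_bad_rays: "(\<lambda>\<xi>. map \<xi> [0..<n]) ` bad_rays x = {v. persistent x v \<and> length v = n}"
proof safe
  fix v assume "persistent x v" "n = length v"
  then show "v \<in> (\<lambda>\<xi>. map \<xi> [0..<length v]) ` bad_rays x"
    using persistent_imp_ray by (metis (no_types, lifting) image_iff)
qed (auto simp: bad_ray_persistent)

lemma bad_rays_nonempty: "bad_rays x \<noteq> {}"
  using persistent_imp_ray[OF persistent_root] by blast

lemma persistent_equivariant:
  assumes "g \<in> G" "persistent x v"
  shows "persistent (act g x) (g v)"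
  unfolding persistent_def
proof (intro conjI allI impI)
  have v: "v \<in> V" using assms by (simp add: persistent_def)
  then show "g v \<in> V" using assms by simp
  fix n assume "n \<ge> length (g v)"
  then have "n \<ge> length v" using assms by simp
  then obtain w where w: "w \<in> subtree m v" "length w = n" "\<not> dcomm w \<subseteq> stab x"
    using assms unfolding persistent_def by blast
  then show "\<exists>w\<in>subtree m (g v). length w = n \<and> \<not> dcomm w \<subseteq> stab (act g x)"
    using assms(1) v subtree_vertices
    by (intro bexI[of _ "g w"]) (auto simp: dcomm_stab_equivariant)
qed

text \<open>The openness in \<open>open_fix_dcomm\<close> is what counts: each level contributes a
  finite union of complements of open sets.\<close>

lemma closed_persistent: "closed {x. persistent x v}"
proof (cases "v \<in> V")
  case True
  have "{x. persistent x v} =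
      (\<Inter>n\<in>{length v..}. \<Union>w\<in>{w\<in>subtree m v. length w = n}. - {x. dcomm w \<subseteq> stab x})"
    using True unfolding persistent_def by blast
  moreover have "closed (\<Inter>n\<in>{length v..}. \<Union>w\<in>{w\<in>subtree m v. length w = n}. - {x. dcomm w \<subseteq> stab x})"
    using open_fix_dcomm subtree_vertices
    by (intro closed_INT ballI closed_UN finite_subtree_level) (auto intro!: closed_Compl)
  ultimately show ?thesis by simp
next
  case False then show ?thesis by (simp add: persistent_def)
qed

text \<open>Second use of the counting argument, now for the family of persistence sets on one
  level.\<close>

lemma open_persistent: "v \<in> V \<Longrightarrow> open {x. persistent x v}"
  by (rule equivariant_closed_imp_open[where A = "\<lambda>v. {x. persistent x v}" and n = "length v"])
     (auto simp: closed_persistent persistent_equivariant tree_level_def)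

lemma bad_rays_continuous:
  assumes "e > 0"
  shows "\<exists>U. open U \<and> x \<in> U \<and> (\<forall>y\<in>U. hausdorff_dist (bad_rays x) (bad_rays y) < e)"
proof -
  obtain n where n: "(1/2::real) ^ n < e" using real_arch_pow_inv[OF assms, of "1/2"] by auto
  \<comment> \<open>On \<open>U\<close> the persistent vertices of level \<open>n\<close> are those
    of \<open>x\<close>, so the prefixes of length \<open>n\<close> of bad rays agree.\<close>
  define U where "U = (\<Inter>v\<in>tree_level m n. {y. persistent y v \<longleftrightarrow> persistent x v})"
  have "open {y. persistent y v \<longleftrightarrow> persistent x v}" if "v \<in> tree_level m n" for v
    using open_persistent[of v] closed_persistent[of v] that
    by (cases "persistent x v") (auto simp: tree_level_def closed_def Collect_neg_eq)
  then have "open U" unfolding U_def by (intro open_INT finite_tree_level) auto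
  moreover have "x \<in> U" by (simp add: U_def)
  moreover have "hausdorff_dist (bad_rays x) (bad_rays y) < e" if "y \<in> U" for y
  proof -
    have "{v. persistent x v \<and> length v = n} = {v. persistent y v \<and> length v = n}"
      using that by (auto simp: U_def tree_level_def persistent_def)
    then have "hausdorff_dist (bad_rays x) (bad_rays y) \<le> (1/2) ^ n"
      by (intro hausdorff_dist_le bad_rays_nonempty) (simp add: prefixes_of_bad_rays)
    then show ?thesis using n by simp
  qed
  ultimately show ?thesis by blast
qed

section \<open>Equivariance, closed values and infinite range\<close>

lemma ray_act_bad_rays:
  assumes "g \<in> G" "\<xi> \<in> bad_rays x"
  shows "ray_act g \<xi> \<in> bad_rays (act g x)"
  using assms by (auto simp: bad_rays_def ray_act_in_rays ray_act_prefix dcomm_stab_equivariant prefix_in_tree)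

lemma bad_rays_equivariant:
  assumes "g \<in> G"
  shows "bad_rays (act g x) = ray_act g ` bad_rays x"
proof
  show "ray_act g ` bad_rays x \<subseteq> bad_rays (act g x)" using ray_act_bad_rays assms by blast
  show "bad_rays (act g x) \<subseteq> ray_act g ` bad_rays x"
  proof
    fix \<xi> assume \<xi>: "\<xi> \<in> bad_rays (act g x)"
    have "ray_act (inv g) \<xi> \<in> bad_rays x" using ray_act_bad_rays[OF inv_in_G[OF assms] \<xi>] assms by simp
    moreover have "\<xi> = ray_act g (ray_act (inv g) \<xi>)"
      using ray_act_inv assms \<xi> by (simp add: bad_rays_def)
    ultimately show "\<xi> \<in> ray_act g ` bad_rays x" by blast
  qed
qed

lemma closed_bad_rays: "closedin (boundary_top m) (bad_rays x)"
proof (rule closedin_boundary)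
  fix \<xi> assume "\<xi> \<in> rays m" "\<xi> \<notin> bad_rays x"
  then obtain n where n: "dcomm (map \<xi> [0..<n]) \<subseteq> stab x" by (auto simp: bad_rays_def)
  have "\<eta> \<notin> bad_rays x" if "map \<eta> [0..<n] = map \<xi> [0..<n]" for \<eta>
    using that n unfolding bad_rays_def by (metis (mono_tags, lifting) mem_Collect_eq)
  then show "\<exists>n. \<forall>\<eta>\<in>rays m. map \<eta> [0..<n] = map \<xi> [0..<n] \<longrightarrow> \<eta> \<notin> bad_rays x" by blast
qed (auto simp: bad_rays_def)

text \<open>\<open>stab_contains_dcomm\<close> is applied to one point after another; descending
  further only shrinks \<open>dcomm w\<close>.\<close>

lemma common_dcomm:
  assumes "finite F"
  shows "\<exists>w\<in>V. \<forall>x\<in>F. dcomm w \<subseteq> stab x"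
  using assms
proof (induction F rule: finite_induct)
  case empty
  have "[] \<in> V" by (simp add: tree_vertices_def)
  then show ?case by blast
next
  case (insert y F)
  then obtain w where w: "w \<in> V" "\<forall>x\<in>F. dcomm w \<subseteq> stab x" by blast
  obtain w' where "w' \<in> subtree m w" "dcomm w' \<subseteq> stab y" using stab_contains_dcomm w by blast
  then show ?case using w dcomm_mono[of w' w] subtree_vertices[of w'] by (intro bexI[of _ w']) auto
qed

text \<open>If finitely many points represented all values, a common \<open>w\<close> would be
  avoided by every bad ray of every point; but transitivity on levels moves some bad ray through
  \<open>w\<close>.\<close>

lemma infinite_range_bad_rays: "infinite (range bad_rays)"
proof
  assume "finite (range bad_rays)"
  then obtain F where F: "finite F" "range bad_rays = bad_rays ` F"
    by (metis finite_subset_image order_refl)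
  obtain w where w: "w \<in> V" "\<And>x. x \<in> F \<Longrightarrow> dcomm w \<subseteq> stab x" using common_dcomm[OF F(1)] by blast
  obtain \<xi> where \<xi>: "\<xi> \<in> bad_rays undefined" using bad_rays_nonempty by blast
  have ray: "\<xi> \<in> rays m" using \<xi> by (simp add: bad_rays_def)
  obtain g where g: "g \<in> G" "g (map \<xi> [0..<length w]) = w"
    using transitive[OF prefix_in_tree[OF ray] w(1)] by force
  define \<eta> where "\<eta> = ray_act g \<xi>"
  have \<eta>: "\<eta> \<in> bad_rays (act g undefined)" using ray_act_bad_rays g \<xi> by (simp add: \<eta>_def)
  obtain x where x: "x \<in> F" "bad_rays (act g undefined) = bad_rays x" using F by blast
  have "map \<eta> [0..<length w] = w" using ray_act_prefix g ray by (simp add: \<eta>_def)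
  then have "\<not> dcomm w \<subseteq> stab x"
    using \<eta> x unfolding bad_rays_def by (metis (mono_tags, lifting) mem_Collect_eq)
  then show False using w x by blast
qed

end

theorem theorem6p9:
  fixes m :: "nat \<Rightarrow> nat"
    and G :: "(nat list \<Rightarrow> nat list) set"
    and act :: "(nat list \<Rightarrow> nat list) \<Rightarrow> 'x::t2_space \<Rightarrow> 'x"
    and d :: real
  assumes "aut_group m G"
    and "finitely_generated G"
    and "weakly_branch m G"
    and "compact (UNIV :: 'x set)"
    and "G_action G act"
    and "minimal_action G act"
    and "faithful_action G act"
    and "d \<ge> 1"
    and "\<exists>S. fin_sym_gen_set G S \<and>
           (\<exists>C>0. \<forall>n\<ge>1. real (orbital_growth S act n) \<le> C * (C * real n) powr d)"
  shows "\<exists>q :: 'x \<Rightarrow> (nat \<Rightarrow> nat) set.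
           (\<forall>x. closedin (boundary_top m) (q x))
         \<and> (\<forall>x. \<forall>e>0. \<exists>U. open U \<and> x \<in> U \<and> (\<forall>y\<in>U. hausdorff_dist (q x) (q y) < e))
         \<and> (\<forall>g\<in>G. \<forall>x. q (act g x) = ray_act g ` q x)
         \<and> infinite (range q)"
proof -
  obtain S C where S: "fin_sym_gen_set G S" and C: "C > 0"
    and growth: "\<And>n. n \<ge> 1 \<Longrightarrow> real (orbital_growth S act n) \<le> C * (C * real n) powr d"
    using assms(9) by blast
  interpret small_growth_action m G S act C d
    by unfold_locales (use assms S C growth in auto)
  show ?thesis
    by (intro exI[of _ bad_rays] conjI allI ballI impI closed_bad_rays bad_rays_continuous
        bad_rays_equivariant infinite_range_bad_rays)
qed

end
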